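(* Let $n,p$ be positive integers. The rectangular Capelli-Deruyts bitableau $\mathbf{K}_n^p\in\mathbf{U}(gl(n))$ equals the product of column determinants $$\mathbf{K}_n^p=(-1)^{n\binom{p}{2}}\ \mathbf{H}_n(p-1)\cdots\mathbf{H}_n(1)\ \mathbf{H}_n(0),$$ where, for $q\in\mathbb{N}$, $\mathbf{H}_n(q)=\mathbf{cdet}\big[e_{h,k}+\delta_{hk}(-q+n-h)\big]_{h,k=1,\dots,n}\in\mathbf{U}(gl(n))$.
   Context: $\mathbf{cdet}[a_{hk}]=\sum_\sigma(-1)^{|\sigma|}a_{\sigma(1),1}a_{\sigma(2),2}\cdots a_{\sigma(n),n}$ is the column determinant of a matrix with noncommutative entries; $e_{h,k}$ are the elementary matrices of $gl(n)$. Capelli bitableaux. Let $\mathcal{A}_0=\{\alpha_1,\dots,\alpha_{m}\}$ ($m$ sufficiently large) be a set of virtual symbols, with $|\alpha_s|=0\in\mathbb{Z}_2$, and $\mathcal{L}=\{1,\dots,n\}$ the proper symbols, with $|i|=1\in\mathbb{Z}_2$. Let $gl(m|n)$ be the complex Lie superalgebra with basis $e_{a,b}$, $a,b\in\mathcal{A}_0\cup\mathcal{L}$, of parity $|a|+|b|$, and superbracket $[e_{a,b},e_{c,d}]=\delta_{bc}e_{a,d}-(-1)^{(|a|+|b|)(|c|+|d|)}\delta_{ad}e_{c,b}$. The enveloping algebra $\mathbf{U}(gl(n))$ is the subalgebra of $\mathbf{U}(gl(m|n))$ generated by the $e_{i,j}$, $i,j\in\mathcal{L}$. A product $e_{a_r,b_r}\cdots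 e_{a_1,b_1}$ is irregular if there are $i\le r$ and $\gamma\in\mathcal{A}_0$ with $\#\{j\le i: b_j=\gamma\}>\#\{j<i: a_j=\gamma\}$. Let $\mathbf{Irr}$ be the left ideal of $\mathbf{U}(gl(m|n))$ generated by the irregular products. It is known that $\mathbf{U}(gl(n))\cap\mathbf{Irr}=0$, that $Virt(m,n)=\mathbf{U}(gl(n))\oplus\mathbf{Irr}$ is a subalgebra, and that $\mathbf{Irr}$ is a two-sided ideal of it; the Capelli devirtualization epimorphism $\mathfrak{p}:Virt(m,n)\to\mathbf{U}(gl(n))$ is the projection with kernel $\mathbf{Irr}$. For Young tableaux $S=(s_{ij})$, $T=(t_{ij})$ of the same shape $\lambda=(\lambda_1\ge\dots\ge\lambda_p)$ with entries in $\mathcal{L}$, the Capelli bitableau is $$[S|T]=\mathfrak{p}\Big(\prod_{i=1}^{p}\big(e_{s_{i1},\alpha_i}e_{s_{i2},\alpha_i}\cdots e_{s_{i\lambda_i},\alpha_i}\big)\cdot\prod_{i=1}^{p}\big(e_{\alpha_i,t_{i1}}e_{\alpha_i,t_{i2}}\cdots e_{\alpha_i,t_{i\lambda_i}}\big)\Big),$$ with products ordered from left to right by increasing $i$ and $\alpha_1,\dots,\alpha_p$ distinct virtual symbols (the argument lies in $Virt(m,n)$ and the result does not depend on the choice of the $\alpha_i$). $\mathbf{K}_n^p=[S|T]$ where $S$ and $T$ have $p$ rows, every row of $S$ is $n\ (n-1)\ \cdots\ 2\ 1$ and every row of $T$ is $1\ 2\ \cdots\ n$. *)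

theory Defs
  imports Complex_Main "HOL-Library.Poly_Mapping" "HOL-Combinatorics.Permutations"
begin

text \<open>
  The algebra \<open>U(gl(m|n))\<close> is built as the free associative complex algebra on the symbols
  \<open>e\<^sub>a\<^sub>,\<^sub>b\<close> modulo the relations coming from the superbracket.  The finite types
  \<open>'m\<close> and \<open>'n\<close> are the sets of virtual and of proper symbols.
\<close>

subsection \<open>The free associative algebra\<close>

text \<open>
  The free algebra is the monoid algebra of the free monoid.  Words are a copy of lists, so that
  the additively written monoid required by \<^theory>\<open>HOL-Library.Poly_Mapping\<close> does not
  put a \<open>+\<close> on lists; here \<open>+\<close> is concatenation.
\<close>

datatype 'g word = Word (letters: "'g list")

instantiation word :: (type) monoid_add
begin

definition zero_word :: "'a word" where
  "zero_word = Word []"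

definition plus_word :: "'a word \<Rightarrow> 'a word \<Rightarrow> 'a word" where
  "plus_word v w = Word (letters v @ letters w)"

instance
  by standard (simp_all add: zero_word_def plus_word_def)

end

type_synonym 'g free_algebra = "'g word \<Rightarrow>\<^sub>0 complex"

definition free_scalar :: "complex \<Rightarrow> 'g free_algebra" where
  "free_scalar c = Poly_Mapping.single 0 c"

definition free_gen :: "'g \<Rightarrow> 'g free_algebra" where
  "free_gen g = Poly_Mapping.single (Word [g]) 1"


subsection \<open>The enveloping algebra of \<open>gl(m|n)\<close>\<close>

datatype ('m, 'n) symb = Virtual 'm | Proper 'n

fun parity :: "('m, 'n) symb \<Rightarrow> nat" where
  "parity (Virtual _) = 0"
| "parity (Proper _) = 1"

text \<open>The pair \<open>(a, b)\<close> stands for the basis element \<open>e\<^sub>a\<^sub>,\<^sub>b\<close>.\<close>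

type_synonym ('m, 'n) gl_basis = "('m, 'n) symb \<times> ('m, 'n) symb"

definition koszul_sign :: "('m, 'n) gl_basis \<Rightarrow> ('m, 'n) gl_basis \<Rightarrow> int" where
  "koszul_sign = (\<lambda>(a, b) (c, d). (-1) ^ ((parity a + parity b) * (parity c + parity d)))"

definition superbracket ::
    "('m, 'n) gl_basis \<Rightarrow> ('m, 'n) gl_basis \<Rightarrow> ('m, 'n) gl_basis free_algebra" where
  "superbracket = (\<lambda>(a, b) (c, d).
     (if b = c then free_gen (a, d) else 0)
     - of_int (koszul_sign (a, b) (c, d)) * (if a = d then free_gen (c, b) else 0))"

text \<open>
  The two-sided ideal defining the enveloping algebra.  It is closed under scalars because these
  are elements of the free algebra.
\<close>

inductive_set enveloping_ideal :: "('m, 'n) gl_basis free_algebra set" where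
  zero: "0 \<in> enveloping_ideal"
| add: "x \<in> enveloping_ideal \<Longrightarrow> y \<in> enveloping_ideal \<Longrightarrow> x + y \<in> enveloping_ideal"
| rel: "u * (free_gen g * free_gen h - of_int (koszul_sign g h) * (free_gen h * free_gen g)
          - superbracket g h) * v \<in> enveloping_ideal"

lemma enveloping_ideal_mult_left:
  "x \<in> enveloping_ideal \<Longrightarrow> z * x \<in> enveloping_ideal"
proof (induction rule: enveloping_ideal.induct)
  case (rel u g h v)
  show ?case
    using enveloping_ideal.rel[of "z * u" g h v] by (simp only: mult.assoc)
qed (auto simp: distrib_left intro: enveloping_ideal.intros)

lemma enveloping_ideal_mult_right:
  "x \<in> enveloping_ideal \<Longrightarrow> x * z \<in> enveloping_ideal"
proof (induction rule: enveloping_ideal.induct)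
  case (rel u g h v)
  show ?case
    using enveloping_ideal.rel[of u g h "v * z"] by (simp only: mult.assoc)
qed (auto simp: distrib_right intro: enveloping_ideal.intros)

lemma enveloping_ideal_uminus:
  "x \<in> enveloping_ideal \<Longrightarrow> - x \<in> enveloping_ideal"
  using enveloping_ideal_mult_left[of x "- 1"] by simp

definition enveloping_rel ::
    "('m, 'n) gl_basis free_algebra \<Rightarrow> ('m, 'n) gl_basis free_algebra \<Rightarrow> bool" where
  "enveloping_rel x y \<longleftrightarrow> x - y \<in> enveloping_ideal"

lemma equivp_enveloping_rel:
  "equivp (enveloping_rel :: ('m, 'n) gl_basis free_algebra \<Rightarrow> _)"
proof (rule equivpI)
  show "reflp (enveloping_rel :: ('m, 'n) gl_basis free_algebra \<Rightarrow> _)"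
    by (auto simp: reflp_def enveloping_rel_def intro: enveloping_ideal.zero)
  show "symp (enveloping_rel :: ('m, 'n) gl_basis free_algebra \<Rightarrow> _)"
    by (auto simp: symp_def enveloping_rel_def dest: enveloping_ideal_uminus)
  show "transp (enveloping_rel :: ('m, 'n) gl_basis free_algebra \<Rightarrow> _)"
  proof (rule transpI)
    fix x y z :: "('m, 'n) gl_basis free_algebra"
    assume "enveloping_rel x y" "enveloping_rel y z"
    then have "(x - y) + (y - z) \<in> enveloping_ideal"
      unfolding enveloping_rel_def by (rule enveloping_ideal.add)
    then show "enveloping_rel x z"
      by (simp add: enveloping_rel_def)
  qed
qed

quotient_type ('m, 'n) ugl = "('m, 'n) gl_basis free_algebra" / enveloping_rel
  by (rule equivp_enveloping_rel)

lemma word_add_eq_0_iff: "v + w = 0 \<longleftrightarrow> v = 0 \<and> w = (0 :: 'g word)"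
  by (cases v; cases w) (simp add: zero_word_def plus_word_def)

lemma lookup_mult_0:
  "Poly_Mapping.lookup (x * y) 0
     = Poly_Mapping.lookup x 0 * Poly_Mapping.lookup (y :: 'g free_algebra) 0"
proof -
  have "(\<Sum>q. Poly_Mapping.lookup y q when (0 :: 'g word) = l + q)
      = (Poly_Mapping.lookup y 0 when l = 0)" for l
  proof -
    have "(\<lambda>q. Poly_Mapping.lookup y q when (0 :: 'g word) = l + q)
        = (\<lambda>q. (Poly_Mapping.lookup y q when l = 0) when q = 0)"
      by (auto simp: when_def fun_eq_iff word_add_eq_0_iff dest: sym)
    then show ?thesis
      by (simp only: Sum_any_when_equal)
  qed
  then show ?thesis
    by (simp only: lookup_mult mult_when Sum_any_when_equal)
qed

lemma lookup_free_gen_0: "Poly_Mapping.lookup (free_gen g) 0 = 0"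
  by (simp add: free_gen_def lookup_single zero_word_def when_def)

lemma lookup_enveloping_ideal_0:
  "x \<in> enveloping_ideal \<Longrightarrow> Poly_Mapping.lookup x 0 = 0"
proof (induction rule: enveloping_ideal.induct)
  case (rel u g h v)
  have "Poly_Mapping.lookup (superbracket g h) 0 = 0"
    by (auto simp: superbracket_def lookup_minus lookup_mult_0 lookup_free_gen_0
        split: prod.splits)
  then show ?case
    by (simp add: lookup_minus lookup_mult_0 lookup_free_gen_0)
qed (simp_all add: lookup_add)

instantiation ugl :: (type, type) ring_1
begin

lift_definition zero_ugl :: "('a, 'b) ugl" is 0 .

lift_definition one_ugl :: "('a, 'b) ugl" is 1 .

lift_definition plus_ugl :: "('a, 'b) ugl \<Rightarrow> ('a, 'b) ugl \<Rightarrow> ('a, 'b) ugl" is "(+)"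
  unfolding enveloping_rel_def
  by (metis add_diff_add enveloping_ideal.add)

lift_definition uminus_ugl :: "('a, 'b) ugl \<Rightarrow> ('a, 'b) ugl" is uminus
  unfolding enveloping_rel_def
  by (metis enveloping_ideal_uminus minus_diff_minus)

lift_definition minus_ugl :: "('a, 'b) ugl \<Rightarrow> ('a, 'b) ugl \<Rightarrow> ('a, 'b) ugl" is "(-)"
  unfolding enveloping_rel_def
proof -
  fix x x' y y' :: "('a, 'b) gl_basis free_algebra"
  assume "x - x' \<in> enveloping_ideal" "y - y' \<in> enveloping_ideal"
  then have "(x - x') + - (y - y') \<in> enveloping_ideal"
    by (intro enveloping_ideal.add enveloping_ideal_uminus)
  then show "x - y - (x' - y') \<in> enveloping_ideal"
    by (simp add: algebra_simps)
qed

lift_definition times_ugl :: "('a, 'b) ugl \<Rightarrow> ('a, 'b) ugl \<Rightarrow> ('a, 'b) ugl" is "(*)"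
  unfolding enveloping_rel_def
proof -
  fix x x' y y' :: "('a, 'b) gl_basis free_algebra"
  assume "x - x' \<in> enveloping_ideal" "y - y' \<in> enveloping_ideal"
  then have "(x - x') * y + x' * (y - y') \<in> enveloping_ideal"
    by (intro enveloping_ideal.add enveloping_ideal_mult_left enveloping_ideal_mult_right)
  then show "x * y - x' * y' \<in> enveloping_ideal"
    by (simp add: algebra_simps)
qed

instance
proof
  show "(0 :: ('a, 'b) ugl) \<noteq> 1"
  proof (transfer, unfold enveloping_rel_def, rule notI)
    assume "(0 :: ('a, 'b) gl_basis free_algebra) - 1 \<in> enveloping_ideal"
    from lookup_enveloping_ideal_0[OF this] show False
      by (simp add: lookup_one)
  qed
qed (transfer, simp add: enveloping_rel_def enveloping_ideal.zero algebra_simps)+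

end

lift_definition ugl_scalar :: "complex \<Rightarrow> ('m, 'n) ugl" is free_scalar .

lift_definition ugl_gen :: "('m, 'n) gl_basis \<Rightarrow> ('m, 'n) ugl" is free_gen .

abbreviation egl :: "('m, 'n) symb \<Rightarrow> ('m, 'n) symb \<Rightarrow> ('m, 'n) ugl" where
  "egl a b \<equiv> ugl_gen (a, b)"

text \<open>The subalgebra \<open>U(gl(n))\<close>.\<close>

inductive_set ugl_proper :: "('m, 'n) ugl set" where
  scalar: "ugl_scalar c \<in> ugl_proper"
| gen: "egl (Proper i) (Proper j) \<in> ugl_proper"
| add: "x \<in> ugl_proper \<Longrightarrow> y \<in> ugl_proper \<Longrightarrow> x + y \<in> ugl_proper"
| mult: "x \<in> ugl_proper \<Longrightarrow> y \<in> ugl_proper \<Longrightarrow> x * y \<in> ugl_proper"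


subsection \<open>Irregular products and devirtualization\<close>

text \<open>
  A list \<open>w = [(a\<^sub>r, b\<^sub>r), \<dots>, (a\<^sub>1, b\<^sub>1)]\<close> encodes a product, read from left to
  right.  Indices in the mathematical notation count from the right, hence \<^const>\<open>rev\<close>.
\<close>

definition irregular :: "('m, 'n) gl_basis list \<Rightarrow> bool" where
  "irregular w \<longleftrightarrow> (\<exists>i \<gamma>. 1 \<le> i \<and> i \<le> length w \<and>
     length (filter (\<lambda>(a, b). b = Virtual \<gamma>) (take i (rev w)))
       > length (filter (\<lambda>(a, b). a = Virtual \<gamma>) (take (i - 1) (rev w))))"

inductive_set Irr :: "('m, 'n) ugl set" where
  zero: "0 \<in> Irr"
| add: "x \<in> Irr \<Longrightarrow> y \<in> Irr \<Longrightarrow> x + y \<in> Irr"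
| irregular: "irregular w \<Longrightarrow> x * prod_list (map ugl_gen w) \<in> Irr"

text \<open>
  The projection of \<open>U(gl(n)) \<oplus> Irr\<close> onto \<open>U(gl(n))\<close> along \<open>Irr\<close>;
  the value outside this direct sum is irrelevant.
\<close>

definition devirt :: "('m, 'n) ugl \<Rightarrow> ('m, 'n) ugl" where
  "devirt x = (THE u. u \<in> ugl_proper \<and> x - u \<in> Irr)"


subsection \<open>Capelli bitableaux\<close>

text \<open>
  A tableau is the list of its rows.  The list \<open>\<alpha>s\<close> supplies the virtual symbols, one for
  each row; it has to be distinct and as long as the two tableaux.
\<close>

definition capelli_bitableau :: "'m list \<Rightarrow> 'n list list \<Rightarrow> 'n list list \<Rightarrow> ('m, 'n) ugl" where
  "capelli_bitableau \<alpha>s S T = devirt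
     (prod_list (map2 (\<lambda>\<alpha> row. prod_list (map (\<lambda>s. egl (Proper s) (Virtual \<alpha>)) row)) \<alpha>s S)
      * prod_list (map2 (\<lambda>\<alpha> row. prod_list (map (\<lambda>t. egl (Virtual \<alpha>) (Proper t)) row)) \<alpha>s T))"

text \<open>
  In the rest of the theory \<open>\<iota>\<close> is a bijection from \<open>{1..n}\<close> onto the type
  \<open>'n\<close>, naming the proper symbols \<open>1, \<dots>, n\<close>.
\<close>

definition capelli_deruyts ::
    "'m list \<Rightarrow> nat \<Rightarrow> (nat \<Rightarrow> 'n) \<Rightarrow> nat \<Rightarrow> ('m, 'n) ugl" where
  "capelli_deruyts \<alpha>s n \<iota> p = capelli_bitableau \<alpha>s
     (replicate p (map \<iota> (rev [1..<n + 1]))) (replicate p (map \<iota> [1..<n + 1]))"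

definition cdet :: "nat \<Rightarrow> (nat \<Rightarrow> nat \<Rightarrow> 'a :: ring_1) \<Rightarrow> 'a" where
  "cdet n A = (\<Sum>\<sigma> | \<sigma> permutes {1..n}.
     of_int (sign \<sigma>) * prod_list (map (\<lambda>k. A (\<sigma> k) k) [1..<n + 1]))"

definition capelli_H :: "nat \<Rightarrow> (nat \<Rightarrow> 'n) \<Rightarrow> nat \<Rightarrow> ('m, 'n) ugl" where
  "capelli_H n \<iota> q = cdet n (\<lambda>h k. egl (Proper (\<iota> h)) (Proper (\<iota> k))
     + (if h = k then of_int (- int q + int n - int h) else 0))"

end

theory Submission
  imports Defs "HOL-Library.Function_Algebras"
begin

text \<open>
  For a virtual symbol \<open>\<alpha>\<close> write \<open>c\<^sub>h = e\<^sub>h\<^sub>,\<^sub>\<alpha>\<close> and \<open>d\<^sub>k = e\<^sub>\<alpha>\<^sub>,\<^sub>k\<close>. These elements are odd, and modulo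
  the left ideal \<open>Irr\<close> they behave like fermionic annihilation and creation operators: an
  annihilator of \<open>\<alpha>\<close> kills every word to its right in which all \<open>\<alpha>\<close> that were created have been
  annihilated again. The Capelli-Deruyts bitableau with \<open>p\<close> rows is the devirtualization of \<open>p\<close>
  blocks \<open>c\<^sub>n \<dots> c\<^sub>1\<close> followed by \<open>p\<close> blocks \<open>d\<^sub>1 \<dots> d\<^sub>n\<close>, one of each kind for every \<open>\<alpha>\<close>.

  One row. If a word \<open>w\<close> contains no \<open>\<alpha>\<close>, then \<open>c\<^sub>n \<dots> c\<^sub>1 d\<^sub>1 \<dots> d\<^sub>n w\<close> is congruent to \<open>H\<^sub>n(0) w\<close>
  modulo \<open>Irr\<close> (\<open>capelli_identity\<close>). Moving one \<open>d\<^sub>k\<close> to the left through a product of \<open>m\<close> elements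
  \<open>c\<^sub>h\<close> contracts it with each of them in turn and so performs an expansion along column \<open>k\<close>. When
  the resulting \<open>e\<^sub>h\<^sub>,\<^sub>k\<close> is brought to the front as well, each remaining factor contributes one unit
  to the diagonal entry, so that this entry becomes \<open>e\<^sub>k\<^sub>,\<^sub>k + (m - 1)\<close> whichever rows are left
  (\<open>lowers_raise\<close>). With \<open>m = n - k + 1\<close> this is the diagonal shift in \<open>H\<^sub>n(0)\<close>.

  Several rows. Bring the block of \<open>d\<close>'s of the last row in front of the other \<open>p - 1\<close> such
  blocks, at the cost of the sign \<open>(-1)\<^bsup>n(p - 1)\<^esup>\<close>. The identity for one row, with \<open>w\<close> the product
  of the other blocks, puts \<open>H\<^sub>n(0)\<close> between the remaining \<open>c\<close>'s and \<open>d\<close>'s. A full block \<open>c\<^sub>n \<dots> c\<^sub>1\<close>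
  spans a one-dimensional representation of \<open>gl(n)\<close>, of weight the trace; hence moving it to the
  right past \<open>e\<^sub>i\<^sub>j\<close> subtracts \<open>\<delta>\<^sub>i\<^sub>j\<close> from \<open>e\<^sub>i\<^sub>j\<close> and turns \<open>H\<^sub>n(q)\<close> into \<open>H\<^sub>n(q + 1)\<close>
  (\<open>lowers_capelli_H\<close>). So \<open>H\<^sub>n(0)\<close> leaves the \<open>p - 1\<close> blocks on the left as \<open>H\<^sub>n(p - 1)\<close>, and
  induction on \<open>p\<close> finishes the computation (\<open>capelli_deruyts_mod_Irr\<close>).

  Devirtualization. That a congruence modulo \<open>Irr\<close> determines an element of \<open>U(gl(n))\<close> is the
  statement \<open>proper_Irr_trivial\<close>. It is proved without the theorem of Poincare, Birkhoff and Witt,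
  by an explicit module: the functions from subsets of \<open>'m \<times> 'n\<close> to \<open>U = U(gl(m|n))\<close>, that is, the
  exterior algebra on generators \<open>\<xi>\<^sub>c\<^sub>,\<^sub>j\<close> with coefficients in \<open>U\<close>. It is modelled on the module
  induced from \<open>U(gl(n))\<close> along the parabolic subalgebra spanned by \<open>gl(n)\<close> and the \<open>e\<^sub>a\<^sub>,\<^sub>\<gamma>\<close> with
  \<open>\<gamma>\<close> virtual; taking coefficients in the big algebra \<open>U\<close>, on which only \<open>gl(n)\<close> acts, saves a
  separate construction of \<open>U(gl(n))\<close>. An element \<open>u\<close> of \<open>U(gl(n))\<close> maps the vacuum \<open>1\<close> to \<open>u\<close>,
  whereas irregular products kill the vacuum, because the number of \<open>\<xi>\<^sub>c\<^sub>,\<^sub>j\<close> with a given \<open>c\<close> cannot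
  become negative.
\<close>

section \<open>The universal property of the enveloping algebra\<close>

text \<open>
  The substitution homomorphism. The target is only a ring, so the images of the scalars are part
  of the data.
\<close>

definition free_eval :: "(complex \<Rightarrow> 'r::ring_1) \<Rightarrow> ('g \<Rightarrow> 'r) \<Rightarrow> 'g free_algebra \<Rightarrow> 'r" where
  "free_eval sc G x = (\<Sum>w\<in>Poly_Mapping.keys x. sc (Poly_Mapping.lookup x w)
      * prod_list (map G (letters w)))"

lemma letters_zero: "letters 0 = []"
  by (simp add: zero_word_def)

lemma koszul_sign_cases: "koszul_sign g h = 1 \<or> koszul_sign g h = -1"
  by (cases g; cases h) (auto simp: koszul_sign_def minus_one_power_iff)

lemma free_algebra_induct [case_names zero single_add]:
  assumes "P 0" and "\<And>w c x. P x \<Longrightarrow> P (Poly_Mapping.single w c + x)"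
  shows "P (x :: 'g free_algebra)"
proof (induction x rule: update_induct)
  case (update f a b)
  have "Poly_Mapping.update a b f = Poly_Mapping.single a b + f"
    using update(1) by (intro poly_mapping_eqI)
      (auto simp: lookup_update lookup_add lookup_single when_def in_keys_iff)
  then show ?case using assms(2)[OF update(3)] by simp
qed fact

text \<open>
  A representation of the Lie superalgebra \<open>gl(m|n)\<close> by elements of an associative ring.
\<close>

locale gl_rep =
  fixes sc :: "complex \<Rightarrow> 'r::ring_1" and G :: "('m, 'n) gl_basis \<Rightarrow> 'r"
  assumes sc_add: "sc (r + s) = sc r + sc s"
    and sc_mult: "sc (r * s) = sc r * sc s"
    and sc_one: "sc 1 = 1"
    and sc_commute: "sc r * G g = G g * sc r"
    and G_rel: "G (a, b) * G (c, d) - of_int (koszul_sign (a, b) (c, d)) * (G (c, d) * G (a, b))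
      = (if b = c then G (a, d) else 0)
        - of_int (koszul_sign (a, b) (c, d)) * (if a = d then G (c, b) else 0)"
begin

lemma sc_zero: "sc 0 = 0"
  using sc_add[of 0 0] by simp

lemma free_eval_zero: "free_eval sc G 0 = 0"
  by (simp add: free_eval_def)

lemma free_eval_add: "free_eval sc G (x + y) = free_eval sc G x + free_eval sc G y"
proof -
  have ext: "free_eval sc G z = (\<Sum>w\<in>Poly_Mapping.keys x \<union> Poly_Mapping.keys y. sc
      (Poly_Mapping.lookup z w) * prod_list (map G (letters w)))"
    if "Poly_Mapping.keys z \<subseteq> Poly_Mapping.keys x \<union> Poly_Mapping.keys y" for z
    unfolding free_eval_def
    by (rule sum.mono_neutral_left) (use that in \<open>auto simp: in_keys_iff sc_zero\<close>)
  show ?thesis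
    by (subst (1 2 3) ext) (auto simp: keys_add sum.distrib lookup_add sc_add distrib_right
        intro: subsetD[OF keys_add])
qed

lemma free_eval_uminus: "free_eval sc G (- x) = - free_eval sc G x"
  using free_eval_add[of x "- x"] by (simp add: free_eval_zero eq_neg_iff_add_eq_0 add.commute)

lemma free_eval_diff: "free_eval sc G (x - y) = free_eval sc G x - free_eval sc G y"
  using free_eval_add[of x "- y"] by (simp add: free_eval_uminus)

lemma free_eval_single: "free_eval sc G (Poly_Mapping.single w c)
    = sc c * prod_list (map G (letters w))"
  by (simp add: free_eval_def sc_zero)

lemma sc_commute_word: "sc c * prod_list (map G ws) = prod_list (map G ws) * sc c"
proof (induction ws)
  case (Cons g ws)
  have "sc c * (G g * prod_list (map G ws)) = G g * (sc c * prod_list (map G ws))"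
    by (simp only: mult.assoc[symmetric] sc_commute)
  then show ?case by (simp add: Cons.IH mult.assoc)
qed simp

lemma free_eval_single_mult:
  "free_eval sc G (Poly_Mapping.single w c * y)
    = free_eval sc G (Poly_Mapping.single w c) * free_eval sc G y"
proof (induction y rule: free_algebra_induct)
  case (single_add v d y)
  have "sc c * sc d * (prod_list (map G (letters w)) * prod_list (map G (letters v)))
    = sc c * prod_list (map G (letters w)) * (sc d * prod_list (map G (letters v)))"
    by (metis mult.assoc sc_commute_word)
  then show ?case
    by (simp add: distrib_left free_eval_add single_add mult_single free_eval_single
        plus_word_def sc_mult)
qed (simp add: free_eval_zero)

lemma free_eval_mult: "free_eval sc G (x * y) = free_eval sc G x * free_eval sc G y"
  by (induction x rule: free_algebra_induct)
    (simp_all add: free_eval_zero distrib_right free_eval_add free_eval_single_mult)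

lemma free_eval_one: "free_eval sc G 1 = 1"
  using free_eval_single[of 0 1] by (simp add: letters_zero sc_one)

lemma free_eval_gen: "free_eval sc G (free_gen g) = G g"
  by (simp add: free_gen_def free_eval_single sc_one)

lemma free_eval_ideal: "x \<in> enveloping_ideal \<Longrightarrow> free_eval sc G x = 0"
proof (induction rule: enveloping_ideal.induct)
  case (rel u g h v)
  obtain a b c d where gh: "g = (a, b)" "h = (c, d)" by (cases g; cases h)
  have "free_eval sc G (free_gen g * free_gen h
      - of_int (koszul_sign g h) * (free_gen h * free_gen g) - superbracket g h) = 0"
    using koszul_sign_cases[of g h] G_rel[of a b c d]
    by (auto simp: gh superbracket_def free_eval_diff free_eval_mult free_eval_gen
        free_eval_uminus free_eval_zero free_eval_add free_eval_one
        add_eq_0_iff minus_equation_iff)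
  then show ?case by (simp add: free_eval_mult)
qed (simp_all add: free_eval_zero free_eval_add)

text \<open>
  The homomorphism from the enveloping algebra induced by a representation. The choice of a
  representative is immaterial since the substitution homomorphism vanishes on the ideal of
  relations.
\<close>

definition ugl_eval :: "('m, 'n) ugl \<Rightarrow> 'r" where
  "ugl_eval x = free_eval sc G (rep_ugl x)"

lemma ugl_eval_abs: "ugl_eval (abs_ugl x) = free_eval sc G x"
proof -
  have "rep_ugl (abs_ugl x) - x \<in> enveloping_ideal"
    using Quotient3_rep_abs[OF Quotient3_ugl, of x] equivp_reflp[OF equivp_enveloping_rel]
    by (simp add: enveloping_rel_def)
  from free_eval_ideal[OF this] show ?thesis
    by (simp add: ugl_eval_def free_eval_diff)
qed

lemma abs_ugl_surj: obtains y where "x = abs_ugl y"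
  by (metis Quotient3_abs_rep Quotient3_ugl)

lemma ugl_eval_add: "ugl_eval (x + y) = ugl_eval x + ugl_eval y"
  by (cases x rule: abs_ugl_surj; cases y rule: abs_ugl_surj)
    (simp add: plus_ugl.abs_eq ugl_eval_abs free_eval_add)

lemma ugl_eval_mult: "ugl_eval (x * y) = ugl_eval x * ugl_eval y"
  by (cases x rule: abs_ugl_surj; cases y rule: abs_ugl_surj)
    (simp add: times_ugl.abs_eq ugl_eval_abs free_eval_mult)

lemma ugl_eval_zero: "ugl_eval 0 = 0"
  by (simp add: zero_ugl.abs_eq ugl_eval_abs free_eval_zero)

lemma ugl_eval_gen: "ugl_eval (ugl_gen g) = G g"
  by (simp add: ugl_gen.abs_eq ugl_eval_abs free_eval_gen)

lemma ugl_eval_scalar: "ugl_eval (ugl_scalar c) = sc c"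
  by (simp add: ugl_scalar.abs_eq ugl_eval_abs free_scalar_def free_eval_single zero_word_def)

lemma ugl_eval_one: "ugl_eval 1 = 1"
  by (simp add: one_ugl.abs_eq ugl_eval_abs free_eval_one)

lemma ugl_eval_word: "ugl_eval (prod_list (map ugl_gen w)) = prod_list (map G w)"
  by (induction w) (simp_all add: ugl_eval_one ugl_eval_mult ugl_eval_gen)

end

section \<open>Rings of additive operators\<close>

text \<open>
  Additive operators form a ring, in which the relations of \<open>gl(m|n)\<close> can be verified by computing
  with commutators.
\<close>

typedef (overloaded) ('s, 'r) endo = "{f :: ('s \<Rightarrow> 'r::ring_1) \<Rightarrow> 's \<Rightarrow> 'r. \<forall>x y. f (x + y)
    = f x + f y}"
  morphisms endo_apply Endo
  by (rule exI[of _ "\<lambda>x. x"]) simp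

setup_lifting type_definition_endo

lemma endo_apply_add: "endo_apply f (x + y) = endo_apply f x + endo_apply f y"
  using endo_apply[of f] by simp

lemma endo_apply_zero: "endo_apply f 0 = 0"
  using endo_apply_add[of f 0 0] by simp

lemma endo_eqI: "(\<And>x. endo_apply f x = endo_apply g x) \<Longrightarrow> f = g"
  by (simp add: endo_apply_inject[symmetric] ext)

instantiation endo :: (type, ring_1) ring_1
begin
lift_definition zero_endo :: "('a, 'b) endo" is "\<lambda>_. 0" by simp
lift_definition one_endo :: "('a, 'b) endo" is "\<lambda>x. x" by simp
lift_definition plus_endo :: "('a, 'b) endo \<Rightarrow> ('a, 'b) endo \<Rightarrow> ('a, 'b) endo"
  is "\<lambda>f g x. f x + g x" by (simp add: algebra_simps)
lift_definition minus_endo :: "('a, 'b) endo \<Rightarrow> ('a, 'b) endo \<Rightarrow> ('a, 'b) endo"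
  is "\<lambda>f g x. f x - g x" by (simp add: algebra_simps)
lift_definition uminus_endo :: "('a, 'b) endo \<Rightarrow> ('a, 'b) endo"
  is "\<lambda>f x. - f x" by (simp add: algebra_simps)
lift_definition times_endo :: "('a, 'b) endo \<Rightarrow> ('a, 'b) endo \<Rightarrow> ('a, 'b) endo"
  is "\<lambda>f g x. f (g x)" by simp
instance
proof
  show "(0 :: ('a, 'b) endo) \<noteq> 1"
  proof
    assume "(0 :: ('a, 'b) endo) = 1"
    then have "(0 :: 'b) = 1"
      by transfer (auto simp: fun_eq_iff zero_fun_def dest: spec[of _ "\<lambda>_. 1"])
    then show False by simp
  qed
  fix a b c :: "('a, 'b) endo"
  show "a * (b + c) = a * b + a * c"
    by (rule endo_eqI) (simp add: times_endo.rep_eq plus_endo.rep_eq endo_apply_add)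
qed (transfer; simp add: algebra_simps fun_eq_iff)+
end

lemma endo_apply_sum: "endo_apply (sum f S) x = (\<Sum>i\<in>S. endo_apply (f i) x)"
  by (induction S rule: infinite_finite_induct) (simp_all add: zero_endo.rep_eq plus_endo.rep_eq)

section \<open>The exterior algebra\<close>

text \<open>
  An arbitrary linear order, needed to fix the signs in the exterior algebra.
\<close>

definition linear_index :: "'a :: finite \<Rightarrow> nat" where
  "linear_index = (SOME f. inj f)"

lemma inj_linear_index: "inj (linear_index :: 'a :: finite \<Rightarrow> nat)"
proof -
  have "\<exists>f :: 'a \<Rightarrow> nat. inj f"
    using finite_imp_inj_to_nat_seg[of "UNIV :: 'a set"] by auto
  then show ?thesis unfolding linear_index_def by (rule someI_ex)
qed

lemma linear_index_less_iff: "a \<noteq> b \<Longrightarrow> linear_index a < linear_index b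
    \<longleftrightarrow> \<not> linear_index b < linear_index a"
  by (metis inj_eq inj_linear_index linorder_less_linear order_less_asym)

definition ksign :: "'a :: finite \<Rightarrow> 'a set \<Rightarrow> 'r :: ring_1" where
  "ksign a S = (- 1) ^ card {b \<in> S. linear_index b < linear_index a}"

lemma ksign_cases: "ksign a S = (1 :: 'r :: ring_1) \<or> ksign a S = (- 1 :: 'r)"
  unfolding ksign_def by (auto simp: minus_one_power_iff)

lemma ksign_left_commute: "ksign a S * (x * y) = x * (ksign a S * y :: 'r :: ring_1)"
  using ksign_cases[of a S, where ?'r='r] by (elim disjE) simp_all

lemma ksign_square: "ksign a S * (ksign a S * x) = (x :: 'r :: ring_1)"
  using ksign_cases[of a S, where ?'r='r] by (elim disjE) simp_all

lemma ksign_insert: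
  assumes "b \<notin> S"
  shows "ksign a (insert b S) = (if linear_index b < linear_index a then - ksign a S
      else ksign a S)"
proof -
  have "{x \<in> insert b S. linear_index x < linear_index a}
      = (if linear_index b < linear_index a then insert b {x \<in> S. linear_index x < linear_index a}
          else {x \<in> S. linear_index x < linear_index a})"
    by auto
  then show ?thesis using assms by (simp add: ksign_def)
qed

lemma ksign_remove:
  assumes "b \<in> S"
  shows "ksign a (S - {b}) = (if linear_index b < linear_index a then - ksign a S else ksign a S)"
  using ksign_insert[of b "S - {b}" a] assms by (metis Diff_iff insertI1 insert_Diff minus_minus)

text \<open>
  A function \<open>f\<close> on finite sets stands for the element \<open>\<Sum>S. \<xi>\<^sub>S f(S)\<close> of the exterior algebra,
  where \<open>\<xi>\<^sub>S\<close> is the ordered product of the generators in \<open>S\<close>. Then \<open>create a\<close> is multiplication by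
  \<open>\<xi>\<^sub>a\<close> and \<open>destroy a\<close> is the contraction with the dual of \<open>\<xi>\<^sub>a\<close>.
\<close>

lift_definition create :: "'a :: finite \<Rightarrow> ('a set, 'r :: ring_1) endo"
  is "\<lambda>a f S. if a \<in> S then ksign a S * f (S - {a}) else 0"
  by (auto simp: fun_eq_iff distrib_left)

lift_definition destroy :: "'a :: finite \<Rightarrow> ('a set, 'r :: ring_1) endo"
  is "\<lambda>a f S. if a \<in> S then 0 else ksign a S * f (insert a S)"
  by (auto simp: fun_eq_iff distrib_left)

lift_definition lmul :: "'r :: ring_1 \<Rightarrow> ('s, 'r) endo"
  is "\<lambda>u f S. u * f S"
  by (auto simp: fun_eq_iff distrib_left)

lemma create_create: "create a * create b = - (create b
    * create a :: ('a :: finite set, 'r :: ring_1) endo)"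
proof (rule endo_eqI, rule ext)
  fix f :: "'a set \<Rightarrow> 'r" and S
  show "endo_apply (create a * create b) f S = endo_apply (- (create b * create a)) f S"
    using linear_index_less_iff[of a b] ksign_left_commute[of a S "ksign b S" "f (S - {a, b})"]
    by (auto simp: times_endo.rep_eq uminus_endo.rep_eq create.rep_eq ksign_remove
        Diff_insert2[symmetric]
      insert_commute)
qed

lemma destroy_destroy: "destroy a * destroy b
    = - (destroy b * destroy a :: ('a :: finite set, 'r :: ring_1) endo)"
proof (rule endo_eqI, rule ext)
  fix f :: "'a set \<Rightarrow> 'r" and S
  show "endo_apply (destroy a * destroy b) f S = endo_apply (- (destroy b * destroy a)) f S"
    using linear_index_less_iff[of a b] ksign_left_commute[of a S "ksign b S" "f
        (insert a (insert b S))"]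
    by (auto simp: times_endo.rep_eq uminus_endo.rep_eq destroy.rep_eq ksign_insert insert_commute)
qed

lemma destroy_create: "destroy a * create b = (if a = b then 1 else 0)
    - (create b * destroy a :: ('a :: finite set, 'r :: ring_1) endo)"
proof (rule endo_eqI, rule ext)
  fix f :: "'a set \<Rightarrow> 'r" and S
  have *: "insert a S - {b} = insert a (S - {b})" if "a \<noteq> b" using that by auto
  show "endo_apply (destroy a * create b) f S
      = endo_apply ((if a = b then 1 else 0) - create b * destroy a) f S"
    using linear_index_less_iff[of a b] ksign_left_commute[of a S "ksign b S" "f
        (insert a (S - {b}))"]
    by (auto simp: times_endo.rep_eq minus_endo.rep_eq zero_endo.rep_eq one_endo.rep_eq
        destroy.rep_eq
      create.rep_eq ksign_insert ksign_remove ksign_square insert_absorb *)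
qed

lemma lmul_create: "lmul u * create a = create a * lmul (u :: 'r :: ring_1)"
proof (rule endo_eqI, rule ext)
  fix f :: "'a set \<Rightarrow> 'r" and S
  show "endo_apply (lmul u * create a) f S = endo_apply (create a * lmul u) f S"
    by (simp add: times_endo.rep_eq create.rep_eq lmul.rep_eq ksign_left_commute)
qed

lemma lmul_destroy: "lmul u * destroy a = destroy a * lmul (u :: 'r :: ring_1)"
proof (rule endo_eqI, rule ext)
  fix f :: "'a set \<Rightarrow> 'r" and S
  show "endo_apply (lmul u * destroy a) f S = endo_apply (destroy a * lmul u) f S"
    by (simp add: times_endo.rep_eq destroy.rep_eq lmul.rep_eq ksign_left_commute)
qed

lemma lmul_mult: "lmul (u * v) = lmul u * lmul v"
  by transfer (simp add: fun_eq_iff mult.assoc)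

lemma lmul_add: "lmul (u + v) = lmul u + lmul v"
  by transfer (simp add: fun_eq_iff distrib_right)

lemma lmul_diff: "lmul (u - v) = lmul u - lmul v"
  by transfer (simp add: fun_eq_iff algebra_simps)

lemma lmul_one: "lmul 1 = 1"
  by transfer (simp add: fun_eq_iff)

lemma lmul_zero: "lmul 0 = 0"
  by transfer (simp add: fun_eq_iff)

section \<open>Commutators\<close>

definition commutator :: "'a::ring \<Rightarrow> 'a \<Rightarrow> 'a" where "commutator x y = x * y - y * x"

definition anticommutator :: "'a::ring \<Rightarrow> 'a \<Rightarrow> 'a" where "anticommutator x y = x * y + y * x"

lemma commutator_sum_left: "commutator (sum f S) y = (\<Sum>i\<in>S. commutator (f i) y)"
  by (simp add: commutator_def sum_distrib_left sum_distrib_right sum_subtractf)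

lemma commutator_sum_right: "commutator y (sum f S) = (\<Sum>i\<in>S. commutator y (f i))"
  by (simp add: commutator_def sum_distrib_left sum_distrib_right sum_subtractf)

lemma anticommutator_sum_left: "anticommutator (sum f S) y = (\<Sum>i\<in>S. anticommutator (f i) y)"
  by (simp add: anticommutator_def sum_distrib_left sum_distrib_right sum.distrib)

lemma anticommutator_sum_right: "anticommutator y (sum f S) = (\<Sum>i\<in>S. anticommutator y (f i))"
  by (simp add: anticommutator_def sum_distrib_left sum_distrib_right sum.distrib)

lemma commutator_diff_left: "commutator (x - y) z = commutator x z - commutator y z"
  by (simp add: commutator_def algebra_simps)

lemma commutator_diff_right: "commutator z (x - y) = commutator z x - commutator z y"
  by (simp add: commutator_def algebra_simps)

lemma commutator_mult_right: "commutator x (y * z) = commutator x y * z + y * commutator x z"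
  by (simp add: commutator_def algebra_simps)

text \<open>
  Commutators of quadratic expressions in odd operators reduce to anticommutators.
\<close>

lemma commutator_mult_left_anticommutator: "commutator (x * y) z
    = x * anticommutator y z - anticommutator x z * y"
  by (simp add: commutator_def anticommutator_def algebra_simps)

lemma anticommutator_mult_left: "anticommutator (x * y) z
    = x * anticommutator y z - commutator x z * y"
  by (simp add: commutator_def anticommutator_def algebra_simps)

lemma anticommutator_commute: "anticommutator x y = anticommutator y x"
  by (simp add: anticommutator_def add.commute)

lemma commutator_swap: "commutator x y = - commutator y x"
  by (simp add: commutator_def)

lemma anticommutator_create_create: "anticommutator (create a) (create b) = 0"
  unfolding anticommutator_def by (subst create_create) simp

lemma anticommutator_destroy_destroy: "anticommutator (destroy a) (destroy b) = 0"
  unfolding anticommutator_def by (subst destroy_destroy) simp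

lemma anticommutator_destroy_create: "anticommutator (destroy a) (create b)
    = (if a = b then 1 else 0)"
  unfolding anticommutator_def by (subst destroy_create) simp

lemma anticommutator_create_destroy: "anticommutator (create b) (destroy a)
    = (if a = b then 1 else 0)"
  by (subst anticommutator_commute) (rule anticommutator_destroy_create)

lemma commutator_create_destroy_create: "commutator (create a * destroy b) (create c)
    = (if b = c then create a else 0)"
  by (simp add: commutator_mult_left_anticommutator anticommutator_create_create
      anticommutator_destroy_create)

lemma commutator_create_destroy_destroy: "commutator (create a * destroy b) (destroy c)
    = (if a = c then - destroy b else 0)"
  by (simp add: commutator_mult_left_anticommutator anticommutator_destroy_destroy
      anticommutator_create_destroy)

lemma commutator_create_destroy_create_destroy:
  "commutator (create a * destroy b) (create c * destroy d)
      = (if b = c then create a * destroy d else 0) - (if a = d then create c * destroy b else 0)"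
  by (simp add: commutator_mult_right commutator_create_destroy_create
      commutator_create_destroy_destroy)

lemma commutator_lmul_create: "commutator (lmul u) (create a) = 0"
  by (simp add: commutator_def lmul_create)

lemma commutator_lmul_destroy: "commutator (lmul u) (destroy a) = 0"
  by (simp add: commutator_def lmul_destroy)

section \<open>A module for \<open>gl(m|n)\<close> on the exterior algebra\<close>

lemma ugl_scalar_add: "ugl_scalar (r + s) = ugl_scalar r + ugl_scalar s"
  by transfer (simp add: enveloping_rel_def free_scalar_def single_add enveloping_ideal.zero)

lemma ugl_scalar_mult: "ugl_scalar (r * s) = ugl_scalar r * ugl_scalar s"
  by transfer (simp add: enveloping_rel_def free_scalar_def mult_single enveloping_ideal.zero)

lemma ugl_scalar_one: "ugl_scalar 1 = 1"
  by transfer (simp add: enveloping_rel_def free_scalar_def enveloping_ideal.zero)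

lemma free_scalar_commute: "free_scalar c * x = x * free_scalar c"
  by (induction x rule: free_algebra_induct)
    (simp_all add: distrib_left distrib_right free_scalar_def mult_single mult.commute)

text \<open>
  Scalars are central, so their action on coefficients commutes with every operator of the module.
\<close>

lemma ugl_scalar_commute: "ugl_scalar c * x = x * ugl_scalar c"
  by transfer (simp add: enveloping_rel_def free_scalar_commute enveloping_ideal.zero)

lemma ugl_gen_mult:
  "egl a b * egl c d = of_int (koszul_sign (a, b) (c, d)) * (egl c d * egl a b)
    + ((if b = c then egl a d else 0)
      - of_int (koszul_sign (a, b) (c, d)) * (if a = d then egl c b else 0))"
proof -
  let ?k = "koszul_sign (a, b) (c, d)"
  have k: "abs_ugl (of_int ?k) = of_int ?k"
    using koszul_sign_cases[of "(a, b)" "(c, d)"]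
    by (elim disjE) (simp_all add: uminus_ugl.abs_eq[symmetric] one_ugl.abs_eq[symmetric])
  have abs: "abs_ugl (superbracket (a, b) (c, d)) = (if b = c then egl a d else 0)
      - of_int ?k * (if a = d then egl c b else 0)"
    by (simp add: superbracket_def ugl_gen.abs_eq minus_ugl.abs_eq[symmetric]
        times_ugl.abs_eq[symmetric] k
        zero_ugl.abs_eq[symmetric] if_distrib[of abs_ugl])
  have "abs_ugl (free_gen (a, b) * free_gen (c, d))
      = abs_ugl (of_int ?k * (free_gen (c, d) * free_gen (a, b)) + superbracket (a, b) (c, d))"
    using enveloping_ideal.rel[of 1 "(a, b)" "(c, d)" 1]
    by (simp add: ugl.abs_eq_iff enveloping_rel_def diff_diff_eq)
  then show ?thesis
    by (simp only: plus_ugl.abs_eq[symmetric] times_ugl.abs_eq[symmetric] k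
        ugl_gen.abs_eq[symmetric] abs)
qed

type_synonym ('m, 'n) fock_op = "(('m \<times> 'n) set, ('m, 'n) ugl) endo"

text \<open>
  The operators are dictated by the supercommutation relations and the requirement that \<open>e\<^sub>c\<^sub>,\<^sub>j\<close>
  with \<open>c\<close> virtual acts as \<open>\<xi>\<^sub>c\<^sub>,\<^sub>j\<close>. An \<open>e\<^sub>i\<^sub>j\<close> with both symbols proper acts on the coefficients by
  multiplication and on the generators by \<open>[e\<^sub>i\<^sub>j, \<xi>\<^sub>c\<^sub>,\<^sub>k] = - \<delta>\<^sub>i\<^sub>k \<xi>\<^sub>c\<^sub>,\<^sub>j\<close>.
\<close>

definition op_pp :: "'n \<Rightarrow> 'n \<Rightarrow> ('m :: finite, 'n :: finite) fock_op" where
  "op_pp i j = lmul (egl (Proper i) (Proper j)) - (\<Sum>c\<in>UNIV. create (c, j) * destroy (c, i))"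

definition op_vv :: "'m \<Rightarrow> 'm \<Rightarrow> ('m :: finite, 'n :: finite) fock_op" where
  "op_vv c d = (\<Sum>j\<in>UNIV. create (c, j) * destroy (d, j))"

text \<open>
  Since \<open>e\<^sub>i\<^sub>,\<^sub>c\<close> kills the vacuum, its action comes from its supercommutators with the \<open>\<xi>\<^sub>d\<^sub>,\<^sub>k\<close>, which
  are the operators \<open>op_pp\<close> and \<open>op_vv\<close>. Collecting these contributions gives a formula in which
  \<open>op_vv\<close> is absorbed into the exterior part of \<open>op_pp\<close>.
\<close>

definition op_pv :: "'n \<Rightarrow> 'm \<Rightarrow> ('m :: finite, 'n :: finite) fock_op" where
  "op_pv i c = (\<Sum>j\<in>UNIV. op_pp i j * destroy (c, j))"

fun fock_rep :: "('m :: finite, 'n :: finite) gl_basis \<Rightarrow> ('m, 'n) fock_op" where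
  "fock_rep (Proper i, Proper j) = op_pp i j"
| "fock_rep (Virtual c, Virtual d) = op_vv c d"
| "fock_rep (Proper i, Virtual c) = op_pv i c"
| "fock_rep (Virtual c, Proper i) = create (c, i)"

lemma mult_delta_left: "(if P then x else 0) * y = (if P then x * y else (0 :: 'a :: mult_zero))"
  by simp

lemma mult_delta_right: "y * (if P then x else 0) = (if P then y * x else (0 :: 'a :: mult_zero))"
  by simp

text \<open>
  Sums over an index that a Kronecker delta on pairs pins down.
\<close>

lemma sum_if_conj: "finite S \<Longrightarrow> (\<Sum>c\<in>S. if c = a \<and> P then f c else 0)
    = (if a \<in> S \<and> P then f a else (0 :: 'a :: comm_monoid_add))"
  by (cases P) simp_all

lemma sum_if_conj': "finite S \<Longrightarrow> (\<Sum>c\<in>S. if a = c \<and> P then f c else 0)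
    = (if a \<in> S \<and> P then f a else (0 :: 'a :: comm_monoid_add))"
  by (cases P) simp_all

lemma sum_conj_if: "finite S \<Longrightarrow> (\<Sum>c\<in>S. if P \<and> c = a then f c else 0)
    = (if a \<in> S \<and> P then f a else (0 :: 'a :: comm_monoid_add))"
  by (cases P) simp_all

lemma sum_if_const: "(\<Sum>c\<in>S. if P then f c else 0)
    = (if P then sum f S else (0 :: 'a :: comm_monoid_add))"
  by simp

lemma commutator_pp_create: "commutator (op_pp i j) (create (c, k))
    = (if i = k then - create (c, j) else 0)"
  by (simp add: op_pp_def commutator_diff_left commutator_lmul_create commutator_sum_left
      commutator_create_destroy_create sum_if_conj)

lemma commutator_pp_destroy: "commutator (op_pp i j) (destroy (c, k))
    = (if j = k then destroy (c, i) else 0)"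
  by (simp add: op_pp_def commutator_diff_left commutator_lmul_destroy commutator_sum_left
      commutator_create_destroy_destroy sum_if_conj)

lemma commutator_pp_pp: "commutator (op_pp i j) (op_pp k l)
    = (if j = k then op_pp i l else 0) - (if i = l then op_pp k j else 0)"
  (is "commutator ?A ?B = _")
proof -
  have 1: "commutator ?A (create (c, l) * destroy (c, k))
      = (if j = k then create (c, l) * destroy (c, i) else 0)
          - (if i = l then create (c, j) * destroy (c, k) else 0)" for c
    by (simp add: commutator_mult_right commutator_pp_create commutator_pp_destroy)
  have 2: "commutator (lmul u) (create a * destroy b) = 0" for u a b
    by (simp add: commutator_mult_right commutator_lmul_create commutator_lmul_destroy)
  have 3: "commutator (lmul (egl (Proper i) (Proper j))) (lmul (egl (Proper k) (Proper l)))
    = lmul (if j = k then egl (Proper i) (Proper l) else 0)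
        - lmul (if i = l then egl (Proper k) (Proper j) else 0)"
    by (simp add: commutator_def lmul_mult[symmetric] lmul_diff[symmetric] lmul_zero
        ugl_gen_mult[of "Proper i" "Proper j"] koszul_sign_def)
  \<comment> \<open>The exterior part commutes with multiplications of the coefficients.\<close>
  have 4: "commutator ?A (lmul u) = commutator (lmul (egl (Proper i) (Proper j))) (lmul u)" for u
    by (simp add: op_pp_def commutator_diff_left commutator_sum_left commutator_swap[of "create _
        * destroy _" "lmul u"] 2)
  show ?thesis
    unfolding op_pp_def[of k l] commutator_diff_right commutator_sum_right 1 4 3 sum_subtractf
        sum_if_const
    by (simp add: op_pp_def lmul_zero algebra_simps)
qed

lemma commutator_pp_vv: "commutator (op_pp i j) (op_vv c d) = 0"
  by (simp add: op_vv_def commutator_sum_right commutator_mult_right commutator_pp_create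
      commutator_pp_destroy sum.distrib
      mult_delta_left mult_delta_right)

lemma commutator_pp_pv: "commutator (op_pp i j) (op_pv k c) = (if j = k then op_pv i c else 0)"
  by (simp add: op_pv_def commutator_sum_right commutator_mult_right commutator_pp_pp
      commutator_pp_destroy sum.distrib sum_subtractf
      left_diff_distrib mult_delta_left mult_delta_right)

lemma commutator_vv_vv: "commutator (op_vv a b) (op_vv c d)
    = (if b = c then op_vv a d else 0) - (if a = d then op_vv c b else 0)"
  by (simp add: op_vv_def commutator_sum_left commutator_sum_right
      commutator_create_destroy_create_destroy sum_subtractf sum_if_conj sum_if_conj')

lemma commutator_vv_create: "commutator (op_vv a b) (create (c, k))
    = (if b = c then create (a, k) else 0)"
  by (simp add: op_vv_def commutator_sum_left commutator_create_destroy_create sum_conj_if)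

lemma commutator_vv_destroy: "commutator (op_vv a b) (destroy (c, k))
    = (if a = c then - destroy (b, k) else 0)"
  by (simp add: op_vv_def commutator_sum_left commutator_create_destroy_destroy sum_conj_if)

lemma commutator_vv_pv: "commutator (op_vv a b) (op_pv i c) = (if a = c then - op_pv i b else 0)"
  by (simp add: op_pv_def commutator_sum_right commutator_mult_right commutator_vv_destroy
      commutator_swap[of "op_vv _ _" "op_pp _ _"] commutator_pp_vv
      mult_delta_right sum_negf)

lemma anticommutator_pv_create: "anticommutator (op_pv i c) (create (d, k))
    = (if c = d then op_pp i k else 0) + (if i = k then op_vv d c else 0)"
  by (simp add: op_pv_def op_vv_def anticommutator_sum_left anticommutator_mult_left
      anticommutator_destroy_create commutator_pp_create mult_delta_left mult_delta_right
     sum_conj_if sum.distrib sum_subtractf sum_negf)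

lemma anticommutator_pv_destroy: "anticommutator (op_pv i c) (destroy (d, k))
    = - (destroy (d, i) * destroy (c, k))"
  by (simp add: op_pv_def anticommutator_sum_left anticommutator_mult_left
      anticommutator_destroy_destroy commutator_pp_destroy mult_delta_left sum_negf)

text \<open>
  The bracket of the operators \<open>op_pp\<close> and the failure of \<open>op_pp\<close> to commute with the contractions
  both produce terms \<open>op_pp * destroy * destroy\<close>, and these cancel.
\<close>

lemma anticommutator_pv_pv: "anticommutator (op_pv i c) (op_pv k d) = 0"
proof -
  have "anticommutator (op_pv i c) (op_pp k l * destroy (d, l))
      = op_pp k l * anticommutator (op_pv i c) (destroy (d, l))
          - commutator (op_pp k l) (op_pv i c) * destroy (d, l)" for l
    using anticommutator_mult_left[of "op_pp k l" "destroy (d, l)" "op_pv i c"]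
        by (simp add: anticommutator_commute)
  then have "anticommutator (op_pv i c) (op_pv k d)
      = - (\<Sum>l\<in>UNIV. op_pp k l * (destroy (d, i) * destroy (c, l))) - op_pv k c * destroy (d, i)"
    by (simp add: op_pv_def[of k d] anticommutator_sum_right anticommutator_pv_destroy
        commutator_pp_pv sum_subtractf sum_negf mult_delta_left)
  also have "\<dots> = 0"
    by (simp add: op_pv_def destroy_destroy[of "(d, i)"] sum_distrib_right sum_negf mult.assoc)
  finally show ?thesis .
qed

definition satisfies_rel ::
  "(('m, 'n) gl_basis \<Rightarrow> 'r :: ring_1) \<Rightarrow> ('m, 'n) gl_basis \<Rightarrow> ('m, 'n) gl_basis \<Rightarrow> bool" where
  "satisfies_rel G = (\<lambda>(a, b) (c, d).
    G (a, b) * G (c, d) - of_int (koszul_sign (a, b) (c, d)) * (G (c, d) * G (a, b))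
      = (if b = c then G (a, d) else 0)
        - of_int (koszul_sign (a, b) (c, d)) * (if a = d then G (c, b) else 0))"

lemma koszul_sign_sym: "koszul_sign g h = koszul_sign h g"
  by (cases g; cases h) (simp add: koszul_sign_def mult.commute)

lemma super_commutation_swap:
  fixes x y P Q :: "'r :: ring_1"
  assumes "x - of_int k * y = P - of_int k * Q" and "k = 1 \<or> k = - 1"
  shows "y - of_int k * x = Q - of_int k * P"
  using assms(2)
proof
  assume "k = 1"
  then have "- (x - y) = - (P - Q)" using assms(1) by simp
  then show ?thesis using \<open>k = 1\<close> by simp
next
  assume "k = - 1"
  then show ?thesis using assms(1) by (simp add: add.commute)
qed

text \<open>
  Swapping the two generators multiplies both sides of the relation by the same sign; this leaves
  ten of the sixteen types of pairs of generators to check.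
\<close>

lemma satisfies_rel_sym:
  assumes "satisfies_rel G g h"
  shows "satisfies_rel G h g"
proof (cases g; cases h)
  fix a b c d assume gh: "g = (a, b)" "h = (c, d)"
  show ?thesis
    using super_commutation_swap[OF assms[unfolded gh satisfies_rel_def prod.case]
        koszul_sign_cases]
    by (simp only: gh satisfies_rel_def prod.case koszul_sign_sym[of "(c, d)"] eq_commute[of d a]
        eq_commute[of c b])
qed

lemma satisfies_rel_fock_rep: "satisfies_rel fock_rep g h"
proof -
  have pp: "satisfies_rel fock_rep (Proper i, Proper j) h" for i j and h :: "('a, 'b) gl_basis"
    by (cases h rule: fock_rep.cases)
      (simp_all add: satisfies_rel_def koszul_sign_def commutator_pp_pp[unfolded commutator_def]
          commutator_pp_create[unfolded commutator_def]
        commutator_pp_vv[unfolded commutator_def] commutator_pp_pv[unfolded commutator_def])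
  have vv: "satisfies_rel fock_rep (Virtual c, Virtual d) h" for c d and h :: "('a, 'b) gl_basis"
    by (cases h rule: fock_rep.cases)
      (simp_all add: satisfies_rel_sym[OF pp], 
       simp_all add: satisfies_rel_def koszul_sign_def commutator_vv_vv[unfolded commutator_def]
           commutator_vv_create[unfolded commutator_def]
         commutator_vv_pv[unfolded commutator_def])
  have pv: "satisfies_rel fock_rep (Proper i, Virtual c) h" for i c and h :: "('a, 'b) gl_basis"
    by (cases h rule: fock_rep.cases)
      (simp_all add: satisfies_rel_sym[OF pp] satisfies_rel_sym[OF vv], 
       simp_all add: satisfies_rel_def koszul_sign_def
           anticommutator_pv_pv[unfolded anticommutator_def]
           anticommutator_pv_create[unfolded anticommutator_def])
  have vp: "satisfies_rel fock_rep (Virtual c, Proper i) h" for i c and h :: "('a, 'b) gl_basis"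
    by (cases h rule: fock_rep.cases)
      (simp_all add: satisfies_rel_sym[OF pp] satisfies_rel_sym[OF vv] satisfies_rel_sym[OF pv], 
       simp_all add: satisfies_rel_def koszul_sign_def
           anticommutator_create_create[unfolded anticommutator_def])
  show ?thesis
    by (cases g rule: fock_rep.cases) (simp_all add: pp vv pv vp)
qed

lemma lmul_scalar_fock_rep:
  "lmul (ugl_scalar r) * fock_rep g = fock_rep g * lmul (ugl_scalar r)"
proof -
  have pp: "commutator (lmul (ugl_scalar r)) (op_pp i j) = 0" for i j
    by (simp add: op_pp_def commutator_diff_right commutator_sum_right commutator_mult_right
        commutator_lmul_create commutator_lmul_destroy)
      (simp add: commutator_def lmul_mult[symmetric] ugl_scalar_commute)
  have "commutator (lmul (ugl_scalar r)) (fock_rep g) = 0"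
    by (cases g rule: fock_rep.cases)
      (simp_all add: pp op_vv_def op_pv_def commutator_sum_right commutator_mult_right
          commutator_lmul_create commutator_lmul_destroy)
  then show ?thesis by (simp add: commutator_def)
qed

interpretation fock: gl_rep "\<lambda>r. lmul (ugl_scalar r)" fock_rep
proof
  fix a b c d :: "('a, 'b) symb"
  show "fock_rep (a, b) * fock_rep (c, d)
      - of_int (koszul_sign (a, b) (c, d)) * (fock_rep (c, d) * fock_rep (a, b))
    = (if b = c then fock_rep (a, d) else 0)
      - of_int (koszul_sign (a, b) (c, d)) * (if a = d then fock_rep (c, b) else 0)"
    using satisfies_rel_fock_rep[of "(a, b)" "(c, d)"] by (simp add: satisfies_rel_def)
qed (simp_all add: ugl_scalar_add ugl_scalar_mult ugl_scalar_one lmul_add lmul_mult lmul_one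
    lmul_scalar_fock_rep)

section \<open>The vacuum and the irregular products\<close>

text \<open>
  The coefficient \<open>u\<close> times the empty exterior product.
\<close>

definition vacuum :: "('m, 'n) ugl \<Rightarrow> ('m \<times> 'n) set \<Rightarrow> ('m, 'n) ugl" where
  "vacuum u = (\<lambda>S. if S = {} then u else 0)"

lemma destroy_vacuum: "endo_apply (destroy a) (vacuum u) = 0"
  by (simp add: destroy.rep_eq vacuum_def fun_eq_iff)

lemma lmul_vacuum: "endo_apply (lmul v) (vacuum u) = vacuum (v * u)"
  by (simp add: lmul.rep_eq vacuum_def fun_eq_iff)

lemma op_pp_vacuum: "endo_apply (op_pp i j) (vacuum u) = vacuum (egl (Proper i) (Proper j) * u)"
  by (simp add: op_pp_def minus_endo.rep_eq times_endo.rep_eq endo_apply_sum destroy_vacuum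
      endo_apply_zero lmul_vacuum)

lemma vacuum_add: "vacuum (u + v) = vacuum u + vacuum v"
  by (simp add: vacuum_def fun_eq_iff)

text \<open>
  An element of \<open>U(gl(n))\<close> can be read off from its action on the vacuum with coefficient 1.
\<close>

lemma proper_vacuum:
  "u \<in> ugl_proper \<Longrightarrow> endo_apply (fock.ugl_eval u) (vacuum x) = vacuum (u * x)"
proof (induction arbitrary: x rule: ugl_proper.induct)
  case (scalar c)
  then show ?case by (simp add: fock.ugl_eval_scalar lmul_vacuum)
next
  case (gen i j)
  then show ?case by (simp add: fock.ugl_eval_gen op_pp_vacuum)
next
  case (add u v)
  then show ?case by (simp add: fock.ugl_eval_add plus_endo.rep_eq vacuum_add distrib_right)
next
  case (mult u v)
  then show ?case by (simp add: fock.ugl_eval_mult times_endo.rep_eq mult.assoc)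
qed

text \<open>
  Homogeneity of degree \<open>k\<close> in the generators \<open>\<xi>\<^sub>c\<^sub>,\<^sub>j\<close> with the given \<open>c\<close>. The zero function is
  homogeneous of every degree, and it is the only one in negative degrees.
\<close>

definition has_weight :: "'m \<Rightarrow> int \<Rightarrow> (('m \<times> 'n) set \<Rightarrow> 'r :: zero) \<Rightarrow> bool" where
  "has_weight c k f \<longleftrightarrow> (\<forall>S. f S \<noteq> 0 \<longrightarrow> int (card {j. (c, j) \<in> S}) = k)"

lemma has_weight_zero: "has_weight c k 0"
  by (simp add: has_weight_def)

lemma has_weight_vacuum: "has_weight c 0 (vacuum u)"
  by (simp add: has_weight_def vacuum_def)

lemma has_weight_diff:
  "has_weight c k f \<Longrightarrow> has_weight c k g \<Longrightarrow> has_weight c k (f - g :: _ \<Rightarrow> 'r :: ring_1)"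
  unfolding has_weight_def fun_diff_def by (metis diff_zero diff_0 neg_0_equal_iff_equal)

lemma has_weight_sum:
  "(\<And>i. i \<in> I \<Longrightarrow> has_weight c k (f i)) \<Longrightarrow> has_weight c k (\<Sum>i\<in>I. f i :: _ \<Rightarrow> 'r :: ring_1)"
proof (induction I rule: infinite_finite_induct)
  case (insert i I)
  then have "has_weight c k (f i)" "has_weight c k (sum f I)" by simp_all
  then have "has_weight c k (f i + sum f I)"
    unfolding has_weight_def by (metis add_0 plus_fun_def add.right_neutral)
  then show ?case by (simp only: sum.insert[OF insert(1,2)])
qed (simp_all add: has_weight_zero)

lemma has_weight_lmul: "has_weight c k f \<Longrightarrow> has_weight c k (endo_apply (lmul u) f)"
  unfolding has_weight_def lmul.rep_eq by (metis mult_zero_right)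

lemma has_weight_create:
  assumes "has_weight c k f"
  shows "has_weight c (k + of_bool (a = c)) (endo_apply
      (create (a :: 'm :: finite, j :: 'n :: finite)) f)"
  unfolding has_weight_def
proof (intro allI impI)
  fix S assume "endo_apply (create (a, j)) f S \<noteq> 0"
  then have aj: "(a, j) \<in> S" and nz: "f (S - {(a, j)}) \<noteq> 0"
    by (auto simp: create.rep_eq split: if_splits)
  have k: "int (card {i. (c, i) \<in> S - {(a, j)}}) = k"
    by (rule assms[unfolded has_weight_def, rule_format, OF nz])
  show "int (card {i. (c, i) \<in> S}) = k + of_bool (a = c)"
  proof (cases "a = c")
    case True
    then have "{i. (c, i) \<in> S} = insert j {i. (c, i) \<in> S - {(a, j)}}"
      using aj by auto
    then show ?thesis using True by (simp flip: k)
  next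
    case False
    then have "{i. (c, i) \<in> S - {(a, j)}} = {i. (c, i) \<in> S}" by auto
    then show ?thesis using k False by simp
  qed
qed

lemma has_weight_destroy:
  assumes "has_weight c k f"
  shows "has_weight c (k - of_bool (a = c)) (endo_apply
      (destroy (a :: 'm :: finite, j :: 'n :: finite)) f)"
  unfolding has_weight_def
proof (intro allI impI)
  fix S assume "endo_apply (destroy (a, j)) f S \<noteq> 0"
  then have aj: "(a, j) \<notin> S" and nz: "f (insert (a, j) S) \<noteq> 0"
    by (auto simp: destroy.rep_eq split: if_splits)
  have k: "int (card {i. (c, i) \<in> insert (a, j) S}) = k"
    by (rule assms[unfolded has_weight_def, rule_format, OF nz])
  have "{i. (c, i) \<in> insert (a, j) S} = (if a
      = c then insert j {i. (c, i) \<in> S} else {i. (c, i) \<in> S})"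
    by auto
  then show "int (card {i. (c, i) \<in> S}) = k - of_bool (a = c)"
    using k aj by (auto split: if_splits)
qed

lemma destroy_eq_zero:
  assumes "has_weight c k f" and "k \<le> 0"
  shows "endo_apply (destroy (c, j)) f = (0 :: ('m :: finite \<times> 'n :: finite) set \<Rightarrow> 'r :: ring_1)"
proof (rule ext)
  fix S
  have "card {i. (c, i) \<in> insert (c, j) S} > 0"
    by (subst card_gt_0_iff) auto
  then have "f (insert (c, j) S) = 0"
    using assms unfolding has_weight_def by fastforce
  then show "endo_apply (destroy (c, j)) f S = 0 S"
    by (simp add: destroy.rep_eq)
qed

lemma has_weight_op_pp:
  assumes "has_weight c k f"
  shows "has_weight c k (endo_apply (op_pp i j) f)"
proof -
  have "has_weight c k (endo_apply (create (d, j)) (endo_apply (destroy (d, i)) f))" for d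
    using has_weight_create[OF has_weight_destroy[OF assms, of d i], of d j] by simp
  then show ?thesis
    unfolding op_pp_def minus_endo.rep_eq endo_apply_sum times_endo.rep_eq
    by (rule has_weight_diff[OF has_weight_lmul[OF assms] has_weight_sum])
qed

lemma has_weight_fock_rep:
  assumes "has_weight c k f"
  shows "has_weight c (k + of_bool (fst g = Virtual c) - of_bool (snd g = Virtual c))
    (endo_apply (fock_rep g) f)"
proof (cases g rule: fock_rep.cases)
  case (1 i j)
  then show ?thesis using assms by (simp add: has_weight_op_pp)
next
  case (2 a b)
  have "has_weight c (k - of_bool (b = c) + of_bool (a = c)) (endo_apply (op_vv a b) f)"
    unfolding op_vv_def endo_apply_sum times_endo.rep_eq
    by (intro has_weight_sum has_weight_create has_weight_destroy assms)
  then show ?thesis by (simp add: 2 algebra_simps)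
next
  case (3 i a)
  have "has_weight c (k - of_bool (a = c)) (endo_apply (op_pv i a) f)"
    unfolding op_pv_def endo_apply_sum times_endo.rep_eq
    by (intro has_weight_sum has_weight_op_pp has_weight_destroy assms)
  then show ?thesis by (simp add: 3)
next
  case (4 a i)
  then show ?thesis using has_weight_create[OF assms, of a i] by simp
qed

lemma fock_rep_virtual_eq_zero:
  assumes "has_weight c k f" and "k \<le> 0"
  shows "endo_apply (fock_rep (a, Virtual c)) f = 0"
  by (cases a) (simp_all add: op_vv_def op_pv_def endo_apply_sum times_endo.rep_eq
      destroy_eq_zero[OF assms] endo_apply_zero)

lemma negative_weight_eq_zero: "has_weight c k f \<Longrightarrow> k < 0 \<Longrightarrow> f = 0"
  unfolding has_weight_def fun_eq_iff zero_fun_def by (metis of_nat_less_0_iff)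

definition creations :: "'m \<Rightarrow> ('m, 'n) gl_basis list \<Rightarrow> nat" where
  "creations c w = length (filter (\<lambda>(a, b). a = Virtual c) w)"

definition annihilations :: "'m \<Rightarrow> ('m, 'n) gl_basis list \<Rightarrow> nat" where
  "annihilations c w = length (filter (\<lambda>(a, b). b = Virtual c) w)"

text \<open>
  Irregularity as a property of the suffixes of the word, which are the factors that act first.
\<close>

lemma irregular_iff:
  "irregular w \<longleftrightarrow> (\<exists>u g v c. w = u @ g # v \<and> creations c v < annihilations c (g # v))"
proof
  assume "irregular w"
  then obtain i c where i: "1 \<le> i" "i \<le> length w"
    and less: "length (filter (\<lambda>(a, b). a = Virtual c) (take (i - 1) (rev w)))
      < length (filter (\<lambda>(a, b). b = Virtual c) (take i (rev w)))"
    unfolding irregular_def by auto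
  define k where "k = length w - i"
  have k: "k < length w" "Suc (length w) - i = Suc k" "length w - i = k" using i
      by (auto simp: k_def)
  have "w = take k w @ w ! k # drop (Suc k) w"
    using k by (simp add: id_take_nth_drop)
  moreover have "creations c (drop (Suc k) w) < annihilations c (drop k w)"
    using less i by (simp add: take_rev k(2,3) rev_filter[symmetric] creations_def
        annihilations_def)
  moreover have "drop k w = w ! k # drop (Suc k) w"
    using k by (simp add: Cons_nth_drop_Suc)
  ultimately show "\<exists>u g v c. w = u @ g # v \<and> creations c v < annihilations c (g # v)"
    by metis
next
  assume "\<exists>u g v c. w = u @ g # v \<and> creations c v < annihilations c (g # v)"
  then obtain u g v c where w: "w = u @ g # v" "creations c v < annihilations c (g # v)"
    by auto
  show "irregular w"
    unfolding irregular_def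
    using w by (intro exI[of _ "Suc (length v)"] exI[of _ c])
      (simp add: rev_filter[symmetric] creations_def annihilations_def split: if_splits)
qed

lemma has_weight_word:
  "has_weight c (int (creations c w) - int (annihilations c w))
    (endo_apply (prod_list (map fock_rep w)) (vacuum u))"
proof (induction w)
  case Nil
  then show ?case by (simp add: creations_def annihilations_def one_endo.rep_eq has_weight_vacuum)
next
  case (Cons g w)
  have "int (creations c w) - int (annihilations c w) + of_bool (fst g = Virtual c)
      - of_bool (snd g = Virtual c)
      = int (creations c (g # w)) - int (annihilations c (g # w))"
    by (auto simp: creations_def annihilations_def split: prod.splits)
  then show ?case
    using has_weight_fock_rep[OF Cons, of g] by (simp add: times_endo.rep_eq)
qed

text \<open>
  At the offending letter the degree is at most 0 if that letter annihilates \<open>c\<close>, and negative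
  otherwise. In the second case the vector is already 0; in the first case it contains no \<open>\<xi>\<^sub>c\<^sub>,\<^sub>j\<close>
  that the letter could contract.
\<close>

lemma irregular_vacuum:
  assumes "irregular w"
  shows "endo_apply (prod_list (map fock_rep w)) (vacuum u) = 0"
proof -
  obtain w1 a b v c where w: "w = w1 @ (a, b) # v"
      and less: "creations c v < annihilations c ((a, b) # v)"
    using assms by (auto simp: irregular_iff)
  let ?f = "endo_apply (prod_list (map fock_rep v)) (vacuum u)"
  have "endo_apply (fock_rep (a, b)) ?f = 0"
  proof (cases "b = Virtual c")
    case True
    then have "int (creations c v) - int (annihilations c v) \<le> 0"
      using less by (simp add: annihilations_def)
    from fock_rep_virtual_eq_zero[OF has_weight_word this] show ?thesis
      by (simp add: True)
  next
    case False
    then have "int (creations c v) - int (annihilations c v) < 0"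
      using less by (simp add: annihilations_def)
    from negative_weight_eq_zero[OF has_weight_word this] show ?thesis
      by (simp add: endo_apply_zero)
  qed
  then show ?thesis by (simp add: w times_endo.rep_eq endo_apply_zero)
qed

lemma Irr_vacuum: "x \<in> Irr \<Longrightarrow> endo_apply (fock.ugl_eval x) (vacuum u) = 0"
proof (induction rule: Irr.induct)
  case zero
  then show ?case by (simp add: fock.ugl_eval_zero zero_endo.rep_eq zero_fun_def)
next
  case (add x y)
  then show ?case by (simp add: fock.ugl_eval_add plus_endo.rep_eq)
next
  case (irregular w x)
  then show ?case
    by (simp add: fock.ugl_eval_mult fock.ugl_eval_word times_endo.rep_eq irregular_vacuum
        endo_apply_zero)
qed

text \<open>
  The action on the vacuum recovers elements of \<open>U(gl(n))\<close> and vanishes on \<open>Irr\<close>.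
\<close>

theorem proper_Irr_trivial:
  assumes "u \<in> ugl_proper" and "u \<in> Irr"
  shows "u = (0 :: ('m :: finite, 'n :: finite) ugl)"
proof -
  have "vacuum (u * 1) = (0 :: ('m \<times> 'n) set \<Rightarrow> ('m, 'n) ugl)"
    using proper_vacuum[OF assms(1), of 1] Irr_vacuum[OF assms(2), of 1] by simp
  then have "vacuum u {} = 0" by simp
  then show ?thesis by (simp add: vacuum_def)
qed

lemma Irr_mult_left: "x \<in> Irr \<Longrightarrow> y * x \<in> Irr"
proof (induction rule: Irr.induct)
  case (irregular w x)
  then show ?case using Irr.irregular[of w "y * x"] by (simp add: mult.assoc)
qed (auto simp: distrib_left intro: Irr.intros)

lemma Irr_uminus: "x \<in> Irr \<Longrightarrow> - x \<in> Irr"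
  using Irr_mult_left[of x "- 1"] by simp

lemma Irr_diff: "x \<in> Irr \<Longrightarrow> y \<in> Irr \<Longrightarrow> x - y \<in> Irr"
  using Irr.add[of x "- y"] Irr_uminus[of y] by simp

lemma ugl_scalar_zero: "ugl_scalar 0 = 0"
  using ugl_scalar_add[of 0 0] by simp

lemma ugl_scalar_minus_one: "ugl_scalar (- 1) = - 1"
  using ugl_scalar_add[of 1 "- 1"] by (simp add: ugl_scalar_zero ugl_scalar_one
      eq_neg_iff_add_eq_0 add.commute)

lemma ugl_scalar_of_int: "ugl_scalar (of_int z) = of_int z"
proof (induction z rule: int_induct[of _ 0])
  case (step2 i)
  have "of_int (i - 1) = of_int i + (- 1 :: complex)" by simp
  then show ?case by (simp only: ugl_scalar_add step2 ugl_scalar_minus_one) simp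
qed (simp_all add: ugl_scalar_zero ugl_scalar_add ugl_scalar_one)

lemma ugl_proper_of_int: "of_int z \<in> ugl_proper"
  by (metis ugl_scalar_of_int ugl_proper.scalar)

lemma devirt_eqI:
  assumes "u \<in> ugl_proper" and "x - u \<in> Irr"
  shows "devirt x = (u :: ('m :: finite, 'n :: finite) ugl)"
  unfolding devirt_def
proof (rule the_equality)
  fix v :: "('m, 'n) ugl" assume v: "v \<in> ugl_proper \<and> x - v \<in> Irr"
  have "v + ugl_scalar (- 1) * u \<in> ugl_proper"
    using v assms by (auto intro: ugl_proper.intros)
  then have "v - u \<in> ugl_proper" by (simp add: ugl_scalar_minus_one)
  moreover have "v - u \<in> Irr"
    using Irr_diff[OF assms(2), of "x - v"] v by simp
  ultimately show "v = u" using proper_Irr_trivial[of "v - u"] by simp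
qed (use assms in auto)

section \<open>Anticommuting products\<close>

lemma minus_one_power_left_commute: "(- 1) ^ k * (x * y) = x * ((- 1) ^ k * (y :: 'r :: ring_1))"
  by (cases "even k") simp_all

lemma of_int_left_commute: "of_int z * (x * y) = x * (of_int z * (y :: 'r :: ring_1))"
  by (metis mult.assoc mult_of_int_commute)

lemma anticommute_prod_list:
  fixes x :: "'r :: ring_1"
  assumes "\<And>y. y \<in> set ys \<Longrightarrow> x * y = - (y * x)"
  shows "x * prod_list ys = (- 1) ^ length ys * (prod_list ys * x)"
  using assms
proof (induction ys)
  case (Cons y ys)
  have "x * (y * prod_list ys) = - (y * (x * prod_list ys))"
    using Cons.prems[of y] by (simp flip: mult.assoc)
  also have "x * prod_list ys = (- 1) ^ length ys * (prod_list ys * x)"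
    using Cons by simp
  finally show ?case by (simp add: minus_one_power_left_commute mult.assoc)
qed simp

lemma anticommute_prod_lists:
  fixes xs ys :: "'r :: ring_1 list"
  assumes "\<And>x y. x \<in> set xs \<Longrightarrow> y \<in> set ys \<Longrightarrow> x * y = - (y * x)"
  shows "prod_list xs * prod_list ys = (- 1) ^ (length xs * length ys)
      * (prod_list ys * prod_list xs)"
  using assms
proof (induction xs)
  case (Cons x xs)
  have "x * prod_list xs * prod_list ys = x * ((- 1) ^ (length xs * length ys)
      * (prod_list ys * prod_list xs))"
    using Cons by (simp add: mult.assoc)
  also have "\<dots> = (- 1) ^ (length xs * length ys) * (x * prod_list ys * prod_list xs)"
    by (simp add: minus_one_power_left_commute mult.assoc)
  also have "x * prod_list ys = (- 1) ^ length ys * (prod_list ys * x)"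
    using Cons.prems by (intro anticommute_prod_list) simp
  finally show ?case by (simp add: power_add mult.assoc) (metis power_add add.commute mult.assoc)
qed simp

section \<open>Expansion along a column\<close>

abbreviation lower :: "'m \<Rightarrow> 'n \<Rightarrow> ('m, 'n) ugl" where
  "lower \<alpha> h \<equiv> egl (Proper h) (Virtual \<alpha>)"

abbreviation raise :: "'m \<Rightarrow> 'n \<Rightarrow> ('m, 'n) ugl" where
  "raise \<alpha> k \<equiv> egl (Virtual \<alpha>) (Proper k)"

abbreviation eprop :: "'n \<Rightarrow> 'n \<Rightarrow> ('m, 'n) ugl" where
  "eprop h k \<equiv> egl (Proper h) (Proper k)"

text \<open>
  Products of the odd elements that annihilate \<open>\<alpha>\<close>, one for each row index in the list.
\<close>

definition lowers :: "'m \<Rightarrow> 'n list \<Rightarrow> ('m, 'n) ugl" where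
  "lowers \<alpha> hs = prod_list (map (lower \<alpha>) hs)"

lemma lower_raise:
  "lower \<alpha> h * raise \<alpha> k = eprop h k + (if h = k then egl (Virtual \<alpha>) (Virtual \<alpha>) else 0)
      - raise \<alpha> k * lower \<alpha> h"
  by (subst ugl_gen_mult) (simp add: koszul_sign_def)

lemma lower_eprop: "lower \<alpha> h * eprop i k = eprop i k * lower \<alpha> h
    - (if h = k then lower \<alpha> i else 0)"
  by (subst ugl_gen_mult) (simp add: koszul_sign_def)

lemma lower_virtual:
  "lower \<alpha> h * egl (Virtual \<alpha>) (Virtual \<alpha>) = (egl (Virtual \<alpha>) (Virtual \<alpha>) + 1) * lower \<alpha> h"
  by (subst ugl_gen_mult) (simp add: koszul_sign_def algebra_simps)

lemma lower_anticommute: "lower \<alpha> h * lower \<beta> i = - (lower \<beta> i * lower \<alpha> h)"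
  by (subst ugl_gen_mult) (simp add: koszul_sign_def)

lemma raise_anticommute: "raise \<alpha> h * raise \<beta> i = - (raise \<beta> i * raise \<alpha> h)"
  by (subst ugl_gen_mult) (simp add: koszul_sign_def)

lemma lowers_Nil [simp]: "lowers \<alpha> [] = 1"
  by (simp add: lowers_def)

lemma lowers_Cons [simp]: "lowers \<alpha> (h # hs) = lower \<alpha> h * lowers \<alpha> hs"
  by (simp add: lowers_def)

lemma lowers_append: "lowers \<alpha> (hs @ is) = lowers \<alpha> hs * lowers \<alpha> is"
  by (simp add: lowers_def)

lemma lower_lowers: "lower \<alpha> h * lowers \<alpha> hs = (- 1) ^ length hs * (lowers \<alpha> hs * lower \<alpha> h)"
  unfolding lowers_def
  using anticommute_prod_list[of "map (lower \<alpha>) hs" "lower \<alpha> h"] by (auto intro: lower_anticommute)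

lemma minus_one_power_sum_cancel:
  "s < m \<Longrightarrow> (- 1) ^ (m - Suc s) * ((- 1) ^ s * x) = (- 1) ^ (m - 1) * (x :: 'r :: ring_1)"
  by (simp flip: power_add mult.assoc)

text \<open>
  Expansion along column \<open>k\<close>. Moving \<open>e\<^sub>\<alpha>\<^sub>,\<^sub>k\<close> to the left produces, for each position \<open>s\<close>, the
  element \<open>e\<^sub>h\<^sub>,\<^sub>k + \<delta>\<^sub>h\<^sub>k e\<^sub>\<alpha>\<^sub>,\<^sub>\<alpha>\<close> (where \<open>h = hs ! s\<close>) in place of the annihilator \<open>e\<^sub>h\<^sub>,\<^sub>\<alpha>\<close>. This element
  is then moved to the front. Commuting \<open>e\<^sub>\<alpha>\<^sub>,\<^sub>\<alpha>\<close> past an annihilator adds 1; commuting \<open>e\<^sub>h\<^sub>,\<^sub>k\<close> past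
  \<open>e\<^sub>k\<^sub>,\<^sub>\<alpha>\<close> replaces the latter by \<open>e\<^sub>h\<^sub>,\<^sub>\<alpha>\<close>, which up to sign restores the product without \<open>e\<^sub>k\<^sub>,\<^sub>\<alpha>\<close>. So
  the annihilators to the left and to the right of \<open>e\<^sub>k\<^sub>,\<^sub>\<alpha>\<close> contribute 1 each to the diagonal entry,
  and together they contribute \<open>length hs - 1\<close>.
\<close>

lemma lowers_raise:
  fixes \<alpha> :: 'm and k :: 'n
  shows "lowers \<alpha> hs * raise \<alpha> k = (- 1) ^ length hs * (raise \<alpha> k * lowers \<alpha> hs)
    + (\<Sum>s<length hs. (- 1) ^ (length hs - Suc s)
        * ((eprop (hs ! s) k + (if hs ! s = k then egl (Virtual \<alpha>) (Virtual \<alpha>)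
            + of_nat (length hs - 1) else 0))
          * lowers \<alpha> (take s hs @ drop (Suc s) hs)))"
proof (induction hs)
  case Nil
  then show ?case by simp
next
  case (Cons h hs)
  let ?m = "length hs" and ?z = "egl (Virtual \<alpha>) (Virtual \<alpha>) :: ('m, 'n) ugl"
  let ?x = "\<lambda>s. lowers \<alpha> (take s hs @ drop (Suc s) hs)"
  let ?t = "\<lambda>s. eprop (hs ! s) k + (if hs ! s = k then ?z + of_nat (?m - 1) else 0)"
  let ?t' = "\<lambda>s. eprop (hs ! s) k + (if hs ! s = k then ?z + of_nat ?m else 0)"
  \<comment> \<open>Putting the contracted row back at the front recovers the whole product up to sign.\<close>
  have move: "lower \<alpha> (hs ! s) * ?x s = (- 1) ^ s * lowers \<alpha> hs" if "s < ?m" for s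
  proof -
    have "lowers \<alpha> hs = lowers \<alpha> (take s hs) * lower \<alpha> (hs ! s) * lowers \<alpha> (drop (Suc s) hs)"
      by (subst id_take_nth_drop[OF that]) (simp add: lowers_append mult.assoc)
    moreover have "lower \<alpha> (hs ! s) * lowers \<alpha> (take s hs)
        = (- 1) ^ s * (lowers \<alpha> (take s hs) * lower \<alpha> (hs ! s))"
      using that by (simp add: lower_lowers)
    ultimately show ?thesis by (simp add: lowers_append flip: mult.assoc)
  qed
  \<comment> \<open>The new front annihilator is moved behind the entry: one unit from \<open>e\<^sub>\<alpha>\<^sub>,\<^sub>\<alpha>\<close> and one correction
  if \<open>h = k\<close>.\<close>
  have step: "lower \<alpha> h * (?t s * ?x s)
      = ?t' s * (lower \<alpha> h * ?x s) - (if h = k then (- 1) ^ s * lowers \<alpha> hs else 0)" if "s < ?m"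
          for s
  proof -
    have "(of_nat (?m - 1) :: ('m, 'n) ugl) + 1 = of_nat ?m"
      using that by (metis Suc_pred' add.commute of_nat_Suc less_nat_zero_code not_gr_zero)
    then have "lower \<alpha> h * (?z + of_nat (?m - 1)) = (?z + of_nat ?m) * lower \<alpha> h"
      using lower_virtual[of h \<alpha>] mult_of_nat_commute[of "?m - 1" "lower \<alpha> h"]
      by (simp add: distrib_left distrib_right flip: \<open>of_nat (?m - 1) + 1 = of_nat ?m\<close>)
    then have "lower \<alpha> h * ?t s = ?t' s * lower \<alpha> h - (if h = k then lower \<alpha> (hs ! s) else 0)"
      using lower_eprop[of h \<alpha> "hs ! s" k] by (simp add: distrib_left distrib_right)
    then have "lower \<alpha> h * ?t s * ?x s = (?t' s * lower \<alpha> h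
        - (if h = k then lower \<alpha> (hs ! s) else 0)) * ?x s"
      by simp
    then show ?thesis using move[OF that] by (simp add: left_diff_distrib mult.assoc)
  qed
  have "lowers \<alpha> (h # hs) * raise \<alpha> k = lower \<alpha> h * (lowers \<alpha> hs * raise \<alpha> k)"
    by (simp add: mult.assoc)
  also have "\<dots> = (- 1) ^ ?m * (lower \<alpha> h * raise \<alpha> k * lowers \<alpha> hs)
      + (\<Sum>s<?m. (- 1) ^ (?m - Suc s) * (lower \<alpha> h * (?t s * ?x s)))"
    by (simp add: Cons.IH distrib_left sum_distrib_left minus_one_power_left_commute mult.assoc)
  also have "(\<Sum>s<?m. (- 1) ^ (?m - Suc s) * (lower \<alpha> h * (?t s * ?x s)))
      = (\<Sum>s<?m. (- 1) ^ (?m - Suc s) * (?t' s * (lower \<alpha> h * ?x s)))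
        - (\<Sum>s<?m. if h = k then (- 1) ^ (?m - 1) * lowers \<alpha> hs else 0)"
    unfolding sum_subtractf[symmetric]
    by (rule sum.cong) (simp_all add: step right_diff_distrib minus_one_power_sum_cancel)
  \<comment> \<open>The corrections all equal the same product; there are \<open>length hs\<close> of them.\<close>
  also have "(\<Sum>s<?m. if h = k then (- 1) ^ (?m - 1) * lowers \<alpha> hs else 0)
      = - ((- 1) ^ ?m * ((if h = k then of_nat ?m else 0) * lowers \<alpha> hs))"
    by (cases hs) (simp_all add: minus_one_power_left_commute)
  also have "lower \<alpha> h * raise \<alpha> k * lowers \<alpha> hs
      = (eprop h k + (if h = k then ?z else 0)) * lowers \<alpha> hs - raise \<alpha> k * lowers \<alpha> (h # hs)"
    by (simp add: lower_raise left_diff_distrib mult.assoc)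
  finally show ?case
    by (simp add: sum.lessThan_Suc_shift right_diff_distrib distrib_left distrib_right
        del: sum.lessThan_Suc cong: if_cong)
qed

section \<open>Columns and transpositions\<close>

text \<open>
  The rows that are still available when columns \<open>k, \<dots>, n\<close> remain, in the order in which they
  occur in a bitableau: the row attached to column \<open>k\<close> is the last one.
\<close>

definition column_rows :: "nat \<Rightarrow> nat \<Rightarrow> (nat \<Rightarrow> 'n) \<Rightarrow> 'n list" where
  "column_rows n k \<rho> = map \<rho> (rev [k..<Suc n])"

lemma length_column_rows: "length (column_rows n k \<rho>) = Suc n - k"
  by (simp add: column_rows_def del: upt_Suc)

text \<open>
  Deleting the row at \<open>b\<close> amounts to letting the row at \<open>k\<close> take its place. Thus the sign of the
  expansion becomes the sign of the transposition of \<open>k\<close> and \<open>b\<close>, and permutations can be split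
  off by transpositions.
\<close>

lemma column_rows_delete:
  fixes \<alpha> :: 'm and \<rho> :: "nat \<Rightarrow> 'n"
  assumes "k \<le> b" "b \<le> n"
  shows "(- 1) ^ (b - k) * lowers \<alpha> (map \<rho> (rev [Suc b..<Suc n]) @ map \<rho> (rev [k..<b]))
    = (if b = k then 1 else - 1) * lowers \<alpha> (column_rows n (Suc k) (\<rho> \<circ> transpose k b))"
proof (cases "b = k")
  case True
  then show ?thesis by (simp add: column_rows_def)
next
  case False
  then have kb: "k < b" using assms by simp
  let ?A = "lowers \<alpha> (map \<rho> (rev [Suc b..<Suc n]))" and ?B = "lowers \<alpha> (map \<rho> (rev [Suc k..<b]))"
  have "[Suc k..<Suc n] = [Suc k..<b] @ b # [Suc b..<Suc n]"
    using kb assms upt_add_eq_append[of "Suc k" b "Suc n - b"] upt_conv_Cons[of b "Suc n"]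
    by (simp del: upt_Suc)
  moreover have "map (\<rho> \<circ> transpose k b) (rev [Suc k..<b]) = map \<rho> (rev [Suc k..<b])"
    "map (\<rho> \<circ> transpose k b) (rev [Suc b..<Suc n]) = map \<rho> (rev [Suc b..<Suc n])"
    using kb by (auto simp: transpose_def)
  ultimately have "column_rows n (Suc k) (\<rho> \<circ> transpose k b)
      = map \<rho> (rev [Suc b..<Suc n]) @ \<rho> k # map \<rho> (rev [Suc k..<b])"
    unfolding column_rows_def by (simp del: upt_Suc)
  then have 1: "lowers \<alpha> (column_rows n (Suc k) (\<rho> \<circ> transpose k b)) = ?A * (lower \<alpha> (\<rho> k) * ?B)"
    by (simp add: lowers_append del: upt_Suc)
  have "[k..<b] = k # [Suc k..<b]" using kb by (rule upt_conv_Cons)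
  then have 2: "lowers \<alpha> (map \<rho> (rev [Suc b..<Suc n]) @ map \<rho> (rev [k..<b]))
      = ?A * (?B * lower \<alpha> (\<rho> k))"
    by (simp add: lowers_append del: upt_Suc)
  have "lower \<alpha> (\<rho> k) * ?B = (- 1) ^ (b - Suc k) * (?B * lower \<alpha> (\<rho> k))"
    by (simp add: lower_lowers)
  moreover have "(- 1) ^ (b - k) = - ((- 1) ^ (b - Suc k) :: ('m, 'n) ugl)"
    using Suc_diff_Suc[OF kb] by (metis power_Suc mult_minus1)
  ultimately show ?thesis
    using False unfolding 1 2 by (simp add: minus_one_power_left_commute)
qed

lemma lowers_column_raise:
  assumes "k \<le> n"
  shows "lowers \<alpha> (column_rows n k \<rho>) * raise \<alpha> i
    = (- 1) ^ (Suc n - k) * (raise \<alpha> i * lowers \<alpha> (column_rows n k \<rho>))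
    + (\<Sum>b = k..n. of_int (sign (transpose k b))
        * ((eprop (\<rho> b) i + (if \<rho> b = i then egl (Virtual \<alpha>) (Virtual \<alpha>) + of_nat (n - k) else 0))
          * lowers \<alpha> (column_rows n (Suc k) (\<rho> \<circ> transpose k b))))"
proof -
  let ?hs = "column_rows n k \<rho>"
  let ?M = "\<lambda>b. eprop (\<rho> b) i + (if \<rho> b = i then egl (Virtual \<alpha>) (Virtual \<alpha>) + of_nat (n - k)
      else 0)"
  have nth: "?hs ! s = \<rho> (n - s)" if "s < Suc n - k" for s
    using that by (simp add: column_rows_def rev_nth del: upt_Suc)
  have del: "take s ?hs @ drop (Suc s) ?hs = map \<rho> (rev [Suc (n - s)..<Suc n]) @ map \<rho>
      (rev [k..<n - s])"
    if "s < Suc n - k" for s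
    using that by (simp add: column_rows_def take_map drop_map take_rev drop_rev take_upt drop_upt
        Suc_diff_le del: upt_Suc)
  have "(\<Sum>s<Suc n - k. (- 1) ^ (Suc n - k - Suc s)
        * ((eprop (?hs ! s) i + (if ?hs ! s = i then egl (Virtual \<alpha>) (Virtual \<alpha>)
            + of_nat (Suc n - k - 1) else 0))
          * lowers \<alpha> (take s ?hs @ drop (Suc s) ?hs)))
     = (\<Sum>b = k..n. of_int (sign (transpose k b))
         * (?M b * lowers \<alpha> (column_rows n (Suc k) (\<rho> \<circ> transpose k b))))"
  proof (rule sum.reindex_bij_witness[of _ "\<lambda>b. n - b" "\<lambda>s. n - s"])
    fix s assume "s \<in> {..<Suc n - k}"
    then have s: "s < Suc n - k" by simp
    let ?x = "lowers \<alpha> (map \<rho> (rev [Suc (n - s)..<Suc n]) @ map \<rho> (rev [k..<n - s]))"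
    have e: "Suc n - k - Suc s = n - s - k" by simp
    have "(- 1) ^ (Suc n - k - Suc s) * (?M (n - s) * ?x) = ?M (n - s) * ((- 1) ^ (n - s - k) * ?x)"
      unfolding e by (rule minus_one_power_left_commute)
    also have "(- 1) ^ (n - s - k) * ?x
        = of_int (sign (transpose k (n - s)))
            * lowers \<alpha> (column_rows n (Suc k) (\<rho> \<circ> transpose k (n - s)))"
      using s assms by (subst column_rows_delete) (auto simp: sign_swap_id)
    finally have term_eq: "(- 1) ^ (Suc n - k - Suc s) * (?M (n - s) * ?x)
      = of_int (sign (transpose k (n - s))) * (?M (n - s)
          * lowers \<alpha> (column_rows n (Suc k) (\<rho> \<circ> transpose k (n - s))))"
      by (simp only: of_int_left_commute)
    have e': "Suc n - k - 1 = n - k" by simp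
    show "of_int (sign (transpose k (n - s)))
        * (?M (n - s) * lowers \<alpha> (column_rows n (Suc k) (\<rho> \<circ> transpose k (n - s))))
      = (- 1) ^ (Suc n - k - Suc s)
        * ((eprop (?hs ! s) i + (if ?hs ! s = i then egl (Virtual \<alpha>) (Virtual \<alpha>)
            + of_nat (Suc n - k - 1) else 0))
          * lowers \<alpha> (take s ?hs @ drop (Suc s) ?hs))"
      unfolding nth[OF s] del[OF s] e' by (rule term_eq[symmetric])
  qed (use assms in auto)
  then show ?thesis
    using lowers_raise[of \<alpha> ?hs i] by (simp only: length_column_rows)
qed

section \<open>Words modulo irregular products\<close>

definition word_prod :: "('m, 'n) gl_basis list \<Rightarrow> ('m, 'n) ugl" where
  "word_prod w = prod_list (map ugl_gen w)"

lemma word_prod_Nil [simp]: "word_prod [] = 1"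
  by (simp add: word_prod_def)

lemma word_prod_Cons [simp]: "word_prod (g # w) = ugl_gen g * word_prod w"
  by (simp add: word_prod_def)

lemma word_prod_append: "word_prod (v @ w) = word_prod v * word_prod w"
  by (simp add: word_prod_def)

lemma creations_simps [simp]:
  "creations c [] = 0"
  "creations c ((a, b) # w) = (if a = Virtual c then 1 else 0) + creations c w"
  "creations c (v @ w) = creations c v + creations c w"
  by (simp_all add: creations_def)

lemma annihilations_simps [simp]:
  "annihilations c [] = 0"
  "annihilations c ((a, b) # w) = (if b = Virtual c then 1 else 0) + annihilations c w"
  "annihilations c (v @ w) = annihilations c v + annihilations c w"
  by (simp_all add: annihilations_def)

definition raise_word :: "'m \<Rightarrow> 'n list \<Rightarrow> ('m, 'n) gl_basis list" where
  "raise_word \<alpha> ks = map (\<lambda>k. (Virtual \<alpha>, Proper k)) ks"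

definition lower_word :: "'m \<Rightarrow> 'n list \<Rightarrow> ('m, 'n) gl_basis list" where
  "lower_word \<alpha> hs = map (\<lambda>h. (Proper h, Virtual \<alpha>)) hs"

lemma creations_raise_word: "creations c (raise_word \<alpha> ks) = (if \<alpha> = c then length ks else 0)"
  by (induction ks) (auto simp: raise_word_def)

lemma annihilations_raise_word [simp]: "annihilations c (raise_word \<alpha> ks) = 0"
  by (induction ks) (auto simp: raise_word_def)

lemma creations_lower_word [simp]: "creations c (lower_word \<alpha> hs) = 0"
  by (induction hs) (auto simp: lower_word_def)

lemma annihilations_lower_word: "annihilations c (lower_word \<alpha> hs)
    = (if \<alpha> = c then length hs else 0)"
  by (induction hs) (auto simp: lower_word_def)

lemma word_prod_lower_word: "word_prod (lower_word \<alpha> hs) = lowers \<alpha> hs"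
  by (simp add: word_prod_def lower_word_def lowers_def o_def)

text \<open>
  The only source of irregular products used below: no \<open>c\<close> is left to be annihilated by the first
  factor.
\<close>

lemma annihilate_Irr:
  assumes "creations c w \<le> annihilations c w"
  shows "egl a (Virtual c) * word_prod w \<in> Irr"
proof -
  have "irregular ((a, Virtual c) # w)"
    unfolding irregular_iff using assms
    by (intro exI[of _ "[]"] exI[of _ "(a, Virtual c)"] exI[of _ w] exI[of _ c]) simp
  from Irr.irregular[OF this, of 1] show ?thesis by (simp add: word_prod_def)
qed

section \<open>Capelli's identity\<close>

text \<open>
  The entries of \<open>H\<^sub>n(0)\<close>. The shift is \<open>n - j\<close> for the column \<open>j\<close>, which on the diagonal is also
  the row; this form lets the expansion by columns work with arbitrary rows.
\<close>

definition capelli_entry :: "nat \<Rightarrow> (nat \<Rightarrow> 'n) \<Rightarrow> 'n \<Rightarrow> nat \<Rightarrow> ('m, 'n) ugl" where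
  "capelli_entry n \<iota> h j = eprop h (\<iota> j) + (if h = \<iota> j then of_nat (n - j) else 0)"

lemma Irr_sum: "(\<And>i. i \<in> S \<Longrightarrow> f i \<in> Irr) \<Longrightarrow> sum f S \<in> Irr"
  by (induction S rule: infinite_finite_induct) (auto intro: Irr.intros)

text \<open>
  The recursion of a column determinant with respect to its first column. Permutations of \<open>{k..n}\<close>
  are written as \<open>transpose k b \<circ> q\<close> with \<open>q\<close> fixing \<open>k\<close>; the transposition is absorbed into the
  assignment \<open>\<rho>\<close> of rows.
\<close>

lemma capelli_minor_expand:
  fixes E :: "'n \<Rightarrow> nat \<Rightarrow> 'r :: ring_1"
  assumes "k \<le> n"
  shows "(\<Sum>p | p permutes {k..n}. of_int (sign p) * prod_list (map (\<lambda>j. E (\<rho> (p j)) j) [k..<Suc n]))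
    = (\<Sum>b = k..n. of_int (sign (transpose k b)) * (E (\<rho> b) k
        * (\<Sum>q | q permutes {Suc k..n}. of_int (sign q)
            * prod_list (map (\<lambda>j. E ((\<rho> \<circ> transpose k b) (q j)) j) [Suc k..<Suc n]))))"
proof -
  have ins: "{k..n} = insert k {Suc k..n}" and notin: "k \<notin> {Suc k..n}" using assms by auto
  have step: "of_int (sign (transpose k b \<circ> q))
        * prod_list (map (\<lambda>j. E (\<rho> ((transpose k b \<circ> q) j)) j) [k..<Suc n])
      = of_int (sign (transpose k b)) * (E (\<rho> b) k * (of_int (sign q)
          * prod_list (map (\<lambda>j. E ((\<rho> \<circ> transpose k b) (q j)) j) [Suc k..<Suc n])))"
    if q: "q permutes {Suc k..n}" for b q
  proof -
    have "q k = k" using q by (rule permutes_not_in) simp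
    moreover have "sign (transpose k b \<circ> q) = sign (transpose k b) * sign q"
      using q by (intro sign_compose permutation_swap_id
          permutes_imp_permutation[of "{Suc k..n}"]) simp_all
    moreover have "[k..<Suc n] = k # [Suc k..<Suc n]"
      using assms by (intro upt_conv_Cons) simp
    ultimately show ?thesis
      by (simp add: o_def mult.assoc of_int_left_commute[of "sign q" "E (\<rho> b) k"] del: upt_Suc)
  qed
  show ?thesis
    unfolding ins sum_over_permutations_insert[OF finite_atLeastAtMost notin] sum_distrib_left
    by (rule sum.cong[OF refl], rule sum.cong[OF refl], rule step) simp
qed

text \<open>
  Downward induction on \<open>k\<close>, removing one creation operator in each step. In the expansion along
  the column two kinds of terms are irregular: the one in which \<open>e\<^sub>\<alpha>\<^sub>,\<^sub>k\<close> has passed all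
  annihilators, since then there are more annihilations than creations of \<open>\<alpha>\<close>; and the
  contribution of \<open>e\<^sub>\<alpha>\<^sub>,\<^sub>\<alpha>\<close>, since it is applied when every \<open>\<alpha>\<close> has been annihilated. What remains is
  the recursion of the column determinant.
\<close>

lemma capelli_expansion:
  fixes \<alpha> :: 'm and \<rho> \<iota> :: "nat \<Rightarrow> 'n"
  assumes "k \<le> Suc n" and "creations \<alpha> v \<le> annihilations \<alpha> v"
  shows "lowers \<alpha> (column_rows n k \<rho>) * word_prod (raise_word \<alpha> (map \<iota> [k..<Suc n]) @ v)
    - (\<Sum>p | p permutes {k..n}. of_int (sign p)
        * prod_list (map (\<lambda>j. capelli_entry n \<iota> (\<rho> (p j)) j) [k..<Suc n])) * word_prod v \<in> Irr"
  using assms(1)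
proof (induction k arbitrary: \<rho> rule: inc_induct)
  case base
  have "{p :: nat \<Rightarrow> nat. p permutes {Suc n..n}} = {id}"
    by (auto simp: permutes_empty)
  then show ?case by (simp add: column_rows_def raise_word_def Irr.zero)
next
  case (step k)
  then have kn: "k \<le> n" by simp
  define z :: "('m, 'n) ugl" where "z = egl (Virtual \<alpha>) (Virtual \<alpha>)"
  define D where "D = raise_word \<alpha> (map \<iota> [Suc k..<Suc n]) @ v"
  define X where "X \<rho> = lowers \<alpha> (column_rows n (Suc k) \<rho>) * word_prod D" for \<rho>
  define S where "S \<rho> = (\<Sum>p | p permutes {Suc k..n}. of_int (sign p)
    * prod_list (map (\<lambda>j. capelli_entry n \<iota> (\<rho> (p j)) j) [Suc k..<Suc n])) * word_prod v" for \<rho>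
  let ?E = "capelli_entry n \<iota>"
  have upt: "[k..<Suc n] = k # [Suc k..<Suc n]"
    using kn by (intro upt_conv_Cons) simp
  have cD: "creations \<alpha> D \<le> n - k + annihilations \<alpha> D"
    using assms(2) by (simp add: D_def creations_raise_word del: upt_Suc)
  have IH: "X \<rho> - S \<rho> \<in> Irr" for \<rho>
    using step.IH unfolding X_def S_def D_def .
  \<comment> \<open>In \<open>X\<close> no \<open>\<alpha>\<close> is left: all that were created have been annihilated.\<close>
  have zX: "z * X \<rho> \<in> Irr" for \<rho>
    using annihilate_Irr[of \<alpha> "lower_word \<alpha> (column_rows n (Suc k) \<rho>) @ D" "Virtual \<alpha>"] cD
    by (simp add: z_def X_def word_prod_append word_prod_lower_word annihilations_lower_word
        length_column_rows)
  have "column_rows n k \<rho> = \<rho> n # map \<rho> (rev [k..<n])"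
    using kn by (simp add: column_rows_def)
  \<comment> \<open>Behind the leftmost annihilator the \<open>\<alpha>\<close> are already used up.\<close>
  then have last: "lowers \<alpha> (column_rows n k \<rho>) * word_prod D \<in> Irr"
    using annihilate_Irr[of \<alpha> "lower_word \<alpha> (map \<rho> (rev [k..<n])) @ D" "Proper (\<rho> n)"] cD
    by (simp add: word_prod_append word_prod_lower_word annihilations_lower_word mult.assoc)
  have entry: "eprop h (\<iota> k) + (if h = \<iota> k then egl (Virtual \<alpha>) (Virtual \<alpha>) + of_nat (n - k) else 0)
      = ?E h k + (if h = \<iota> k then z else 0)" for h
    by (simp add: capelli_entry_def z_def)
  have "lowers \<alpha> (column_rows n k \<rho>) * word_prod (raise_word \<alpha> (map \<iota> [k..<Suc n]) @ v)
      = lowers \<alpha> (column_rows n k \<rho>) * raise \<alpha> (\<iota> k) * word_prod D"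
    unfolding upt by (simp add: D_def raise_word_def mult.assoc del: upt_Suc)
  also have "\<dots> = (- 1) ^ (Suc n - k) * (raise \<alpha> (\<iota> k)
      * (lowers \<alpha> (column_rows n k \<rho>) * word_prod D))
    + (\<Sum>b = k..n. of_int (sign (transpose k b))
        * ((?E (\<rho> b) k + (if \<rho> b = \<iota> k then z else 0)) * X (\<rho> \<circ> transpose k b)))"
    unfolding lowers_column_raise[OF kn] entry
    by (simp add: distrib_right[of _ _ "word_prod D"] sum_distrib_right X_def mult.assoc)
  finally have X: "lowers \<alpha> (column_rows n k \<rho>) * word_prod (raise_word \<alpha> (map \<iota> [k..<Suc n]) @ v)
    = (- 1) ^ (Suc n - k) * (raise \<alpha> (\<iota> k) * (lowers \<alpha> (column_rows n k \<rho>) * word_prod D))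
    + (\<Sum>b = k..n. of_int (sign (transpose k b))
        * ((?E (\<rho> b) k + (if \<rho> b = \<iota> k then z else 0)) * X (\<rho> \<circ> transpose k b)))" .
  have S: "(\<Sum>p | p permutes {k..n}. of_int (sign p)
        * prod_list (map (\<lambda>j. ?E (\<rho> (p j)) j) [k..<Suc n])) * word_prod v
    = (\<Sum>b = k..n. of_int (sign (transpose k b)) * (?E (\<rho> b) k * S (\<rho> \<circ> transpose k b)))"
    unfolding capelli_minor_expand[OF kn, of ?E] S_def
    by (simp add: sum_distrib_right mult.assoc del: upt_Suc)
  have "(\<Sum>b = k..n. of_int (sign (transpose k b))
      * (?E (\<rho> b) k * (X (\<rho> \<circ> transpose k b) - S (\<rho> \<circ> transpose k b))
      + (if \<rho> b = \<iota> k then z * X (\<rho> \<circ> transpose k b) else 0))) \<in> Irr"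
    using zX by (intro Irr_sum Irr_mult_left Irr.add IH) (auto intro: Irr.zero)
  from Irr.add[OF Irr_mult_left[OF Irr_mult_left[OF last]] this]
  have "(- 1) ^ (Suc n - k) * (raise \<alpha> (\<iota> k) * (lowers \<alpha> (column_rows n k \<rho>) * word_prod D))
    + (\<Sum>b = k..n. of_int (sign (transpose k b))
        * (?E (\<rho> b) k * (X (\<rho> \<circ> transpose k b) - S (\<rho> \<circ> transpose k b))
      + (if \<rho> b = \<iota> k then z * X (\<rho> \<circ> transpose k b) else 0))) \<in> Irr" .
  also have "(\<Sum>b = k..n. of_int (sign (transpose k b))
      * (?E (\<rho> b) k * (X (\<rho> \<circ> transpose k b) - S (\<rho> \<circ> transpose k b))
      + (if \<rho> b = \<iota> k then z * X (\<rho> \<circ> transpose k b) else 0)))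
    = (\<Sum>b = k..n. of_int (sign (transpose k b))
        * ((?E (\<rho> b) k + (if \<rho> b = \<iota> k then z else 0)) * X (\<rho> \<circ> transpose k b)))
    - (\<Sum>b = k..n. of_int (sign (transpose k b)) * (?E (\<rho> b) k * S (\<rho> \<circ> transpose k b)))"
    unfolding sum_subtractf[symmetric] by (rule sum.cong) (simp_all add: algebra_simps)
  finally show ?case unfolding X S by (simp add: add_diff_eq)
qed

section \<open>Passing a full block of annihilators\<close>

text \<open>
  Uses that 2 is invertible among the scalars.
\<close>

lemma self_negative_eq_zero:
  assumes "x = - x"
  shows "x = (0 :: ('m, 'n) ugl)"
proof -
  have "x = ugl_scalar (1 / 2 + 1 / 2) * x" by (simp add: ugl_scalar_one)
  also have "\<dots> = ugl_scalar (1 / 2) * (x + x)"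
    by (simp only: ugl_scalar_add distrib_left distrib_right)
  also have "x + x = 0" using assms by (simp add: eq_neg_iff_add_eq_0)
  finally show ?thesis by simp
qed

lemma lower_lowers_lower: "lower \<alpha> h * (lowers \<alpha> hs * lower \<alpha> h) = 0"
proof -
  have "lower \<alpha> h * lower \<alpha> h = 0"
    by (rule self_negative_eq_zero) (rule lower_anticommute)
  then have "lower \<alpha> h * lowers \<alpha> hs * lower \<alpha> h = 0"
    by (simp add: lower_lowers mult.assoc)
  then show ?thesis by (simp add: mult.assoc)
qed

lemma lowers_not_distinct:
  assumes "\<not> distinct hs"
  shows "lowers \<alpha> hs = 0"
proof -
  obtain us h vs ws where "hs = us @ [h] @ vs @ [h] @ ws"
    using not_distinct_decomp[OF assms] by blast
  then have "lowers \<alpha> hs = lowers \<alpha> us * (lower \<alpha> h * (lowers \<alpha> vs * lower \<alpha> h)) * lowers \<alpha> ws"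
    by (simp add: lowers_append mult.assoc)
  then show ?thesis by (simp add: lower_lowers_lower)
qed

lemma lowers_eprop_absent:
  "k \<notin> set hs \<Longrightarrow> lowers \<alpha> hs * eprop i k = eprop i k * lowers \<alpha> hs"
proof (induction hs)
  case (Cons h hs)
  then have "lowers \<alpha> (h # hs) * eprop i k = lower \<alpha> h * eprop i k * lowers \<alpha> hs"
    by (simp add: mult.assoc)
  also have "lower \<alpha> h * eprop i k = eprop i k * lower \<alpha> h"
    using Cons.prems by (auto simp: lower_eprop)
  finally show ?case by (simp add: mult.assoc)
qed simp

text \<open>
  If every row occurs exactly once, replacing \<open>e\<^sub>k\<^sub>,\<^sub>\<alpha>\<close> by \<open>e\<^sub>i\<^sub>,\<^sub>\<alpha>\<close> with \<open>i \<noteq> k\<close> creates a repeated odd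
  factor, so the commutator survives on the diagonal only.
\<close>

lemma lowers_eprop:
  assumes "distinct hs" and "set hs = UNIV"
  shows "lowers \<alpha> hs * eprop i k = (eprop i k - (if i = k then 1 else 0)) * lowers \<alpha> hs"
proof -
  obtain us vs where hs: "hs = us @ k # vs"
    using assms(2) by (metis UNIV_I split_list)
  have k: "k \<notin> set us" "k \<notin> set vs" using assms(1) hs by auto
  have "lowers \<alpha> hs * eprop i k = lowers \<alpha> us * (lower \<alpha> k * (lowers \<alpha> vs * eprop i k))"
    by (simp add: hs lowers_append mult.assoc)
  also have "lowers \<alpha> vs * eprop i k = eprop i k * lowers \<alpha> vs"
    using k by (simp add: lowers_eprop_absent)
  also have "lower \<alpha> k * (eprop i k * lowers \<alpha> vs)
      = eprop i k * lower \<alpha> k * lowers \<alpha> vs - lower \<alpha> i * lowers \<alpha> vs"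
    by (simp add: lower_eprop left_diff_distrib flip: mult.assoc)
  also have "lowers \<alpha> us * (eprop i k * lower \<alpha> k * lowers \<alpha> vs - lower \<alpha> i * lowers \<alpha> vs)
      = (lowers \<alpha> us * eprop i k) * lower \<alpha> k * lowers \<alpha> vs - lowers \<alpha> (us @ i # vs)"
    by (simp add: right_diff_distrib lowers_append mult.assoc)
  also have "lowers \<alpha> us * eprop i k = eprop i k * lowers \<alpha> us"
    using k by (simp add: lowers_eprop_absent)
  also have "lowers \<alpha> (us @ i # vs) = (if i = k then lowers \<alpha> hs else 0)"
  proof (cases "i = k")
    case False
    then have "i \<in> set us \<union> set vs" using assms(2) hs by auto
    \<comment> \<open>The symbol \<open>i\<close> already occurs in another position.\<close>
    then have "\<not> distinct (us @ i # vs)" by auto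
    then show ?thesis using False by (simp add: lowers_not_distinct)
  qed (simp add: hs)
  finally show ?thesis
    by (auto simp: hs lowers_append left_diff_distrib mult.assoc)
qed

definition deruyts_row :: "nat \<Rightarrow> (nat \<Rightarrow> 'n) \<Rightarrow> 'n list" where
  "deruyts_row n \<iota> = map \<iota> [1..<n + 1]"

definition H_entry :: "nat \<Rightarrow> (nat \<Rightarrow> 'n) \<Rightarrow> nat \<Rightarrow> nat \<Rightarrow> nat \<Rightarrow> ('m, 'n) ugl" where
  "H_entry n \<iota> q h k = eprop (\<iota> h) (\<iota> k) + (if h = k then of_int (- int q + int n - int h) else 0)"

definition all_lowers :: "nat \<Rightarrow> (nat \<Rightarrow> 'n) \<Rightarrow> 'm list \<Rightarrow> ('m, 'n) ugl" where
  "all_lowers n \<iota> \<alpha>s = prod_list (map (\<lambda>\<alpha>. lowers \<alpha> (column_rows n 1 \<iota>)) \<alpha>s)"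

definition all_raises :: "nat \<Rightarrow> (nat \<Rightarrow> 'n) \<Rightarrow> 'm list \<Rightarrow> ('m, 'n) gl_basis list" where
  "all_raises n \<iota> \<alpha>s = concat (map (\<lambda>\<alpha>. raise_word \<alpha> (deruyts_row n \<iota>)) \<alpha>s)"

context
  fixes n :: nat and \<iota> :: "nat \<Rightarrow> 'n :: finite"
  assumes bij: "bij_betw \<iota> {1..n} UNIV"
begin

lemma \<iota>_eq_iff: "i \<in> {1..n} \<Longrightarrow> j \<in> {1..n} \<Longrightarrow> \<iota> i = \<iota> j \<longleftrightarrow> i = j"
  using bij by (auto simp: bij_betw_def dest: inj_onD)

lemma column_rows_UNIV: "distinct (column_rows n 1 \<iota>)" "set (column_rows n 1 \<iota>) = UNIV"
proof -
  have "{Suc 0..<Suc n} = {1..n}" by auto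
  then show "distinct (column_rows n 1 \<iota>)" "set (column_rows n 1 \<iota>) = UNIV"
    using bij by (auto simp: column_rows_def distinct_map bij_betw_def simp del: upt_Suc)
qed

lemma capelli_H_eq: "capelli_H n \<iota> q = cdet n (H_entry n \<iota> q)"
  unfolding capelli_H_def H_entry_def by simp

lemma lowers_H_entry:
  assumes "h \<in> {1..n}" "k \<in> {1..n}"
  shows "lowers \<alpha> (column_rows n 1 \<iota>) * H_entry n \<iota> q h k
      = H_entry n \<iota> (Suc q) h k * lowers \<alpha> (column_rows n 1 \<iota>)"
proof -
  let ?L = "lowers \<alpha> (column_rows n 1 \<iota>)"
  have "?L * of_int z = of_int z * ?L" for z by (metis mult_of_int_commute)
  moreover have "?L * eprop (\<iota> h) (\<iota> k) = (eprop (\<iota> h) (\<iota> k) - (if h = k then 1 else 0)) * ?L"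
    using lowers_eprop[OF column_rows_UNIV, of \<alpha> "\<iota> h" "\<iota> k"] by (simp add: \<iota>_eq_iff[OF assms])
  ultimately have "?L * H_entry n \<iota> q h k = (eprop (\<iota> h) (\<iota> k) - (if h = k then 1 else 0)
      + (if h = k then of_int (- int q + int n - int h) else 0)) * ?L"
    by (simp only: H_entry_def distrib_left distrib_right split: if_split) simp
  also have "eprop (\<iota> h) (\<iota> k) - (if h = k then 1 else 0)
      + (if h = k then of_int (- int q + int n - int h) else 0) = H_entry n \<iota> (Suc q) h k"
    by (simp add: H_entry_def)
  finally show ?thesis .
qed

text \<open>
  The shift by \<open>\<delta>\<^sub>h\<^sub>k\<close> of \<open>lowers_eprop\<close> is the difference of the matrices for \<open>q\<close> and \<open>q + 1\<close>.
\<close>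

lemma lowers_capelli_H:
  "lowers \<alpha> (column_rows n 1 \<iota>) * capelli_H n \<iota> q
      = capelli_H n \<iota> (Suc q) * lowers \<alpha> (column_rows n 1 \<iota>)"
proof -
  let ?L = "lowers \<alpha> (column_rows n 1 \<iota>)"
  have prods: "?L * prod_list (map (\<lambda>k. H_entry n \<iota> q (\<sigma> k) k) ks)
      = prod_list (map (\<lambda>k. H_entry n \<iota> (Suc q) (\<sigma> k) k) ks) * ?L"
    if "set ks \<subseteq> {1..n}" "\<sigma> permutes {1..n}" for \<sigma> ks
    using that(1)
  proof (induction ks)
    case (Cons k ks)
    have "\<sigma> k \<in> {1..n}" "k \<in> {1..n}" using Cons.prems permutes_in_image[OF that(2), of k] by auto
    then have "?L * (H_entry n \<iota> q (\<sigma> k) k * prod_list (map (\<lambda>k. H_entry n \<iota> q (\<sigma> k) k) ks))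
        = H_entry n \<iota> (Suc q) (\<sigma> k) k * (?L * prod_list (map (\<lambda>k. H_entry n \<iota> q (\<sigma> k) k) ks))"
      by (simp only: lowers_H_entry flip: mult.assoc)
    then show ?case using Cons by (simp add: mult.assoc)
  qed simp
  have "?L * (of_int (sign \<sigma>) * prod_list (map (\<lambda>k. H_entry n \<iota> q (\<sigma> k) k) [1..<n + 1]))
      = of_int (sign \<sigma>) * prod_list (map (\<lambda>k. H_entry n \<iota> (Suc q) (\<sigma> k) k) [1..<n + 1]) * ?L"
    if "\<sigma> permutes {1..n}" for \<sigma>
    unfolding of_int_left_commute[symmetric] mult.assoc
    by (intro arg_cong[where f = "(*) (of_int (sign \<sigma>))"] prods that) auto
  then show ?thesis
    unfolding capelli_H_eq cdet_def sum_distrib_left sum_distrib_right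
    by (intro sum.cong refl) simp
qed

text \<open>
  Capelli's identity for one row; the word \<open>v\<close> makes room for the creation operators of the other
  rows.
\<close>

lemma capelli_identity:
  fixes \<alpha> :: 'm
  assumes "creations \<alpha> v \<le> annihilations \<alpha> v"
  shows "lowers \<alpha> (column_rows n 1 \<iota>) * word_prod (raise_word \<alpha> (deruyts_row n \<iota>) @ v)
    - capelli_H n \<iota> 0 * word_prod v \<in> Irr"
proof -
  have entry: "(capelli_entry n \<iota> (\<iota> (\<sigma> j)) j :: ('m, 'n) ugl) = H_entry n \<iota> 0 (\<sigma> j) j"
    if "\<sigma> permutes {1..n}" "j \<in> {1..n}" for \<sigma> j
  proof -
    have "\<sigma> j \<in> {1..n}" using that permutes_in_image by metis
    moreover have "(of_nat (n - j) :: ('m, 'n) ugl) = of_int (int n - int j)"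
      using that by (simp add: of_nat_diff)
    ultimately show ?thesis
      using that by (simp add: capelli_entry_def H_entry_def \<iota>_eq_iff)
  qed
  then have map_eq: "map (\<lambda>j. capelli_entry n \<iota> (\<iota> (\<sigma> j)) j :: ('m, 'n) ugl) [1..<Suc n]
      = map (\<lambda>j. H_entry n \<iota> 0 (\<sigma> j) j) [1..<Suc n]"
    if "\<sigma> permutes {1..n}" for \<sigma>
    using that by (intro map_cong refl entry) auto
  have "(\<Sum>p | p permutes {1..n}. of_int (sign p)
        * prod_list (map (\<lambda>j. capelli_entry n \<iota> (\<iota> (p j)) j) [1..<Suc n]))
            = (capelli_H n \<iota> 0 :: ('m, 'n) ugl)"
    unfolding capelli_H_eq cdet_def
    by (intro sum.cong refl) (simp only: mem_Collect_eq map_eq Suc_eq_plus1[symmetric])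
  with capelli_expansion[of 1 n \<alpha> v \<iota> \<iota>] assms show ?thesis
    by (simp add: deruyts_row_def del: upt_Suc)
qed

lemma capelli_H_proper: "capelli_H n \<iota> q \<in> ugl_proper"
proof -
  have sum: "sum f S \<in> ugl_proper" if "\<And>i. i \<in> S \<Longrightarrow> f i \<in> ugl_proper"
    for f :: "_ \<Rightarrow> ('m, 'n) ugl" and S
    using that by (induction S rule: infinite_finite_induct)
      (auto intro: ugl_proper.intros ugl_proper_of_int[of 0, simplified])
  have prod: "prod_list xs \<in> ugl_proper" if "\<And>x. x \<in> set xs \<Longrightarrow> x \<in> ugl_proper"
    for xs :: "('m, 'n) ugl list"
    using that by (induction xs) (auto intro: ugl_proper.intros ugl_proper_of_int[of 1, simplified])
  have "H_entry n \<iota> q h k \<in> ugl_proper" for h k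
    unfolding H_entry_def using ugl_proper_of_int[of 0]
    by (auto intro!: ugl_proper.add ugl_proper.gen ugl_proper_of_int simp del: of_int_diff
        of_int_add)
  then show ?thesis
    unfolding capelli_H_eq cdet_def
    by (intro sum ugl_proper.mult ugl_proper_of_int prod) auto
qed

lemma all_lowers_Cons:
  "all_lowers n \<iota> (\<alpha> # \<alpha>s) = lowers \<alpha> (column_rows n 1 \<iota>) * all_lowers n \<iota> \<alpha>s"
  by (simp add: all_lowers_def)

lemma all_lowers_capelli_H:
  "all_lowers n \<iota> \<alpha>s * capelli_H n \<iota> q = capelli_H n \<iota> (q + length \<alpha>s) * all_lowers n \<iota> \<alpha>s"
proof (induction \<alpha>s)
  case (Cons \<alpha> \<alpha>s)
  have "all_lowers n \<iota> (\<alpha> # \<alpha>s) * capelli_H n \<iota> q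
      = lowers \<alpha> (column_rows n 1 \<iota>) * capelli_H n \<iota> (q + length \<alpha>s) * all_lowers n \<iota> \<alpha>s"
    by (simp only: all_lowers_Cons mult.assoc Cons.IH)
  then show ?case by (simp only: lowers_capelli_H all_lowers_Cons mult.assoc list.size
      add_Suc_right add_0_right)
qed (simp add: all_lowers_def)

text \<open>
  The block for the last row passes \<open>n * length \<alpha>s\<close> odd factors with each of its \<open>n\<close> factors; the
  sign uses that \<open>n * n\<close> and \<open>n\<close> have the same parity.
\<close>

lemma all_raises_snoc:
  fixes \<alpha>s :: "'m list"
  shows
  "word_prod (all_raises n \<iota> (\<alpha>s @ [\<alpha>]))
    = (- 1) ^ (n * length \<alpha>s) * word_prod (raise_word \<alpha> (deruyts_row n \<iota>) @ all_raises n \<iota> \<alpha>s)"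
proof -
  let ?r = "raise_word \<alpha> (deruyts_row n \<iota>)"
  have len: "length (all_raises n \<iota> \<alpha>s) = length \<alpha>s * n"
    by (induction \<alpha>s) (simp_all add: all_raises_def raise_word_def deruyts_row_def)
  have lenr: "length ?r = n" by (simp add: raise_word_def deruyts_row_def del: upt_Suc)
  have "x * y = - (y * x)" if "x \<in> set (map ugl_gen (all_raises n \<iota> \<alpha>s))" "y \<in> set
      (map ugl_gen ?r)" for x y
    using that by (auto simp: all_raises_def raise_word_def intro: raise_anticommute)
  from anticommute_prod_lists[OF this]
  have "word_prod (all_raises n \<iota> \<alpha>s) * word_prod ?r
      = (- 1) ^ (length \<alpha>s * n * n) * (word_prod ?r * word_prod (all_raises n \<iota> \<alpha>s))"
    by (simp only: word_prod_def length_map len lenr)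
  moreover have "(- 1) ^ (length \<alpha>s * n * n) = ((- 1) ^ (n * length \<alpha>s) :: ('m, 'n) ugl)"
    by (simp add: minus_one_power_iff)
  ultimately show ?thesis
    by (simp add: word_prod_append all_raises_def)
qed

text \<open>
  The last row is eliminated first: its creation operators move in front of the others, the
  one-row identity produces \<open>H\<^sub>n(0)\<close>, and this factor becomes \<open>H\<^sub>n(p)\<close> on passing the annihilators
  of the other \<open>p\<close> rows. The sign exponents add up by \<open>Suc p choose 2 = p + (p choose 2)\<close>.
\<close>

lemma capelli_deruyts_mod_Irr:
  fixes \<alpha>s :: "'m list"
  assumes "distinct \<alpha>s"
  shows "all_lowers n \<iota> \<alpha>s * word_prod (all_raises n \<iota> \<alpha>s)
    - (- 1) ^ (n * (length \<alpha>s choose 2)) * prod_list (map (capelli_H n \<iota>) (rev [0..<length \<alpha>s])) \<in>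
        Irr"
  using assms
proof (induction \<alpha>s rule: rev_induct)
  case Nil
  then show ?case by (simp add: all_lowers_def all_raises_def Irr.zero numeral_2_eq_2)
next
  case (snoc \<alpha> \<alpha>s)
  define p where "p = length \<alpha>s"
  define L where "L = lowers \<alpha> (column_rows n 1 \<iota>)"
  define C where "C = all_lowers n \<iota> \<alpha>s"
  define D where "D = word_prod (all_raises n \<iota> \<alpha>s)"
  define P :: "('m, 'n) ugl" where "P = prod_list (map (capelli_H n \<iota>) (rev [0..<p]))"
  define R where "R = word_prod (raise_word \<alpha> (deruyts_row n \<iota>) @ all_raises n \<iota> \<alpha>s)"
  have "\<alpha> \<notin> set \<alpha>s" using snoc.prems by simp
  then have "creations \<alpha> (all_raises n \<iota> \<alpha>s) = 0"
    by (induction \<alpha>s) (auto simp: all_raises_def creations_raise_word)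
  then have "L * R - capelli_H n \<iota> 0 * D \<in> Irr"
    unfolding L_def R_def D_def by (intro capelli_identity) simp
  then have "C * (L * R - capelli_H n \<iota> 0 * D) \<in> Irr" by (rule Irr_mult_left)
  moreover have "capelli_H n \<iota> p * (C * D - (- 1) ^ (n * (p choose 2)) * P) \<in> Irr"
    using snoc unfolding C_def D_def P_def p_def by (intro Irr_mult_left) simp
  moreover have "C * (capelli_H n \<iota> 0 * D) = capelli_H n \<iota> p * (C * D)"
    using all_lowers_capelli_H[of \<alpha>s 0] by (simp add: C_def p_def flip: mult.assoc)
  ultimately have "C * (L * R) - capelli_H n \<iota> p * ((- 1) ^ (n * (p choose 2)) * P) \<in> Irr"
    using Irr.add[of "C * (L * R - capelli_H n \<iota> 0 * D)"
        "capelli_H n \<iota> p * (C * D - (- 1) ^ (n * (p choose 2)) * P)"]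
    by (simp add: right_diff_distrib)
  then have "(- 1) ^ (n * p) * (C * (L * R) - capelli_H n \<iota> p
      * ((- 1) ^ (n * (p choose 2)) * P)) \<in> Irr"
    by (rule Irr_mult_left)
  moreover have "(- 1) ^ (n * p) * (C * (L * R))
      = all_lowers n \<iota> (\<alpha>s @ [\<alpha>]) * word_prod (all_raises n \<iota> (\<alpha>s @ [\<alpha>]))"
    unfolding all_raises_snoc
    by (simp add: all_lowers_def C_def L_def R_def p_def minus_one_power_left_commute mult.assoc)
  moreover have "Suc p choose 2 = p + (p choose 2)"
    by (simp add: numeral_2_eq_2)
  then have "(- 1) ^ (n * p) * (capelli_H n \<iota> p * ((- 1) ^ (n * (p choose 2)) * P))
      = (- 1) ^ (n * (Suc p choose 2)) * (capelli_H n \<iota> p * P)"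
    by (simp add: power_add distrib_left mult.assoc
        minus_one_power_left_commute[of "n * (p choose 2)" "capelli_H n \<iota> p", symmetric])
  moreover have "capelli_H n \<iota> p * P = prod_list (map (capelli_H n \<iota>) (rev [0..<Suc p]))"
    by (simp add: P_def)
  ultimately show ?case by (simp add: right_diff_distrib p_def del: upt_Suc)
qed

end

section \<open>Rectangular Capelli-Deruyts bitableaux\<close>

lemma map2_replicate: "map2 f xs (replicate (length xs) y) = map (\<lambda>x. f x y) xs"
  by (induction xs) simp_all

theorem corollary7:
  fixes n p :: nat
    and \<iota> :: "nat \<Rightarrow> 'n :: finite"
    and \<alpha>s :: "'m :: finite list"
  assumes "n \<ge> 1" and "p \<ge> 1"
    and "bij_betw \<iota> {1..n} UNIV"
    and "distinct \<alpha>s" and "length \<alpha>s = p"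
  shows "(capelli_deruyts \<alpha>s n \<iota> p :: ('m, 'n) ugl) \<in> ugl_proper \<and>
    (capelli_deruyts \<alpha>s n \<iota> p :: ('m, 'n) ugl)
      = (-1) ^ (n * (p choose 2)) * prod_list (map (capelli_H n \<iota>) (rev [0..<p]))"
proof -
  let ?u = "(-1) ^ (n * (p choose 2)) * prod_list (map (capelli_H n \<iota>) (rev [0..<p])) :: ('m, 'n)
      ugl"
  have "prod_list (map (capelli_H n \<iota>) qs) \<in> (ugl_proper :: ('m, 'n) ugl set)" for qs
    using ugl_proper_of_int[of 1]
    by (induction qs) (auto intro: ugl_proper.mult capelli_H_proper[OF assms(3)])
  then have proper: "?u \<in> ugl_proper"
    using ugl_proper_of_int[of "(- 1) ^ (n * (p choose 2))"] by (auto intro: ugl_proper.mult)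
  have "word_prod (all_raises n \<iota> \<beta>s)
      = prod_list (map (\<lambda>\<alpha>. prod_list (map (raise \<alpha>) (deruyts_row n \<iota>))) \<beta>s)" for \<beta>s :: "'m list"
    by (induction \<beta>s) (simp_all add: all_raises_def raise_word_def word_prod_def o_def)
  moreover have "all_lowers n \<iota> \<beta>s
      = prod_list (map (\<lambda>\<alpha>. prod_list (map (lower \<alpha>) (map \<iota> (rev [1..<n + 1])))) \<beta>s)"
          for \<beta>s :: "'m list"
    by (simp add: all_lowers_def lowers_def column_rows_def)
  ultimately have "capelli_deruyts \<alpha>s n \<iota> p = devirt (all_lowers n \<iota> \<alpha>s
      * word_prod (all_raises n \<iota> \<alpha>s))"
    unfolding capelli_deruyts_def capelli_bitableau_def assms(5)[symmetric] map2_replicate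
    by (simp only: deruyts_row_def)
  also have "\<dots> = ?u"
    using capelli_deruyts_mod_Irr[OF assms(3,4)] assms(5) by (intro devirt_eqI proper) simp
  finally show ?thesis using proper by simp
qed

end
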